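(* Let $f,g$ satisfy the standing assumptions below and let $\beta\ge\max\{\frac{8M_fQ_g}{\mu^3},\frac{4M_fQ_gL_g}{\mu^{3.5}}\}$. Consider Algorithm 3: from $(x_0,y_0)$, for $k=0,1,\dots$: compute $w_k$ with $\|\nabla^2_{yy}g(x_k,y_k)w_k-\nabla_yg(x_k,y_k)\|\le\varepsilon_{1,k}$; choose $(d_{x,k},d_{y,k})\in\mathcal{D}_f(x_k,y_k-w_k)$; set $p_{x,k}=d_{x,k}-\nabla^2_{xy}g(x_k,y_k)\nabla^2_{yy}g(x_k,y_k)^{-1}d_{y,k}$; set $x_{k+1}=x_k-\eta_kp_{x,k}$ and $y_{k+1}=y_k-\eta_k\big(\beta\nabla_yg(x_k,y_k)-\nabla^2_{yx}g(x_k,y_k)\nabla^2_{yy}g(x_k,y_k)^{-1}p_{x,k}\big)$. Suppose: (a) $\sup_k\|x_k\|+\|y_k\|<\infty$; (b) $\eta_k\ge0$, $\sum_k\eta_k=\infty$, $\sum_k\eta_k^2<\infty$; (c) the set $\{f(x,y):(x,y)\text{ is a }\mathcal{D}_f\text{-stationary point of (BLO)}\}$ has empty interior; and $\lim_k\varepsilon_{1,k}=0$. Then every limit point of $\{(x_k,y_k)\}$ is a $\mathcal{D}_f$-stationary point of (BLO), and $\{h(x_k,y_k)\}$ converges.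
   Context: Standing assumptions. (A1) Constants $M_f,\mu,L_g,Q_g>0$ exist such that: $f:\mathbb{R}^n\times\mathbb{R}^p\to\mathbb{R}$ is $M_f$-Lipschitz; $g$ is twice differentiable with $\nabla^2_{yy}g\succeq\mu I_p$; $\nabla g$ is $L_g$-Lipschitz; $\nabla^2_{yy}g,\nabla^2_{xy}g$ are $Q_g$-Lipschitz; $\nabla^2_{yy}g$ is continuously differentiable ($\nabla^2_{xy}g\in\mathbb{R}^{n\times p}$ has entries $\partial^2g/\partial x_i\partial y_j$, $\nabla^2_{yx}g$ is its transpose). (A2) $f$ is a potential function of a conservative field $\mathcal{D}_f$ with compact convex values of norm at most $M_f$ (conservative field: closed graph, nonempty compact values, $\int_0^1\max_{v\in\mathcal{D}(\gamma(t))}\langle\gamma'(t),v\rangle dt=0$ along every absolutely continuous loop; potential: $f(\gamma(1))-f(\gamma(0))$ equals this integral along any absolutely continuous curve). Notation: $\mathcal{A}(x,y):=y-\nabla^2_{yy}g(x,y)^{-1}\nabla_yg(x,y)$, $h(x,y):=f(x,\mathcal{A}(x,y))+\frac\beta2\|\nabla_yg(x,y)\|^2$. $(x,y)$ is a $\mathcal{D}_f$-stationary point of (BLO) (the problem $\min f(x,y)$ s.t. $y=\arg\min_{y'}g(x,y')$) if there is $(d_x,d_y)\in\mathcal{D}_f(x,y)$ with $d_x-\nabla^2_{xy}g(x,y)\nabla^2_{yy}g(x,y)^{-1}d_y=0$ and $\nabla_yg(x,y)=0$.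
   Formalization: In the update of y the printed product ∇²_yx g ∇²_yy g^{-1} p_x is undefined when n ≠ p (a p×n matrix times a p×p matrix); the formal statement uses the well-typed order ∇²_yy g^{-1} ∇²_yx g p_x instead. *)

theory Defs
  imports "HOL-Analysis.Analysis"
begin

definition abs_cont_01 :: "(real \<Rightarrow> 'a::real_normed_vector) \<Rightarrow> bool" where
  "abs_cont_01 \<gamma> \<longleftrightarrow>
     (\<forall>\<epsilon>>0. \<exists>\<delta>>0. \<forall>S :: (real \<times> real) set.
        finite S \<longrightarrow> (\<forall>(a,b)\<in>S. 0 \<le> a \<and> a < b \<and> b \<le> 1) \<longrightarrow>
        (\<forall>(a,b)\<in>S. \<forall>(c,d)\<in>S. (a,b) \<noteq> (c,d) \<longrightarrow> {a<..<b} \<inter> {c<..<d} = {}) \<longrightarrow>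
        (\<Sum>(a,b)\<in>S. b - a) < \<delta> \<longrightarrow> (\<Sum>(a,b)\<in>S. norm (\<gamma> b - \<gamma> a)) < \<epsilon>)"

definition field_integrand ::
  "('a::euclidean_space \<Rightarrow> 'a set) \<Rightarrow> (real \<Rightarrow> 'a) \<Rightarrow> real \<Rightarrow> real" where
  "field_integrand D \<gamma> t = Sup ((\<lambda>v. vector_derivative \<gamma> (at t) \<bullet> v) ` D (\<gamma> t))"

definition conservative_field :: "('a::euclidean_space \<Rightarrow> 'a set) \<Rightarrow> bool" where
  "conservative_field D \<longleftrightarrow>
     closed {(z, v). v \<in> D z} \<and>
     (\<forall>z. D z \<noteq> {} \<and> compact (D z)) \<and>
     (\<forall>\<gamma>. abs_cont_01 \<gamma> \<and> \<gamma> 0 = \<gamma> 1 \<longrightarrow> (field_integrand D \<gamma> has_integral 0) {0..1})"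

definition potential_of :: "('a::euclidean_space \<Rightarrow> real) \<Rightarrow> ('a \<Rightarrow> 'a set) \<Rightarrow> bool" where
  "potential_of f D \<longleftrightarrow>
     (\<forall>\<gamma>. abs_cont_01 \<gamma> \<longrightarrow> (field_integrand D \<gamma> has_integral (f (\<gamma> 1) - f (\<gamma> 0))) {0..1})"

definition opnorm :: "real^'m^'k \<Rightarrow> real" where
  "opnorm A = onorm (\<lambda>v. A *v v)"

text \<open>D_f-stationary point of (BLO). Hxy z is the n x p matrix of mixed second derivatives,
  Hyy z the p x p Hessian in y, gy z the gradient in y.\<close>
definition BLO_stationary ::
  "((real^'n) \<times> (real^'p) \<Rightarrow> ((real^'n) \<times> (real^'p)) set) \<Rightarrow>
   ((real^'n) \<times> (real^'p) \<Rightarrow> real^'p^'n) \<Rightarrow> ((real^'n) \<times> (real^'p) \<Rightarrow> real^'p^'p) \<Rightarrow>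
   ((real^'n) \<times> (real^'p) \<Rightarrow> real^'p) \<Rightarrow> (real^'n) \<times> (real^'p) \<Rightarrow> bool" where
  "BLO_stationary D Hxy Hyy gy z \<longleftrightarrow>
     (\<exists>dx dy. (dx, dy) \<in> D z \<and> dx - Hxy z *v (matrix_inv (Hyy z) *v dy) = 0) \<and> gy z = 0"

definition Amap ::
  "((real^'n) \<times> (real^'p) \<Rightarrow> real^'p^'p) \<Rightarrow> ((real^'n) \<times> (real^'p) \<Rightarrow> real^'p) \<Rightarrow>
   (real^'n) \<times> (real^'p) \<Rightarrow> real^'p" where
  "Amap Hyy gy z = snd z - matrix_inv (Hyy z) *v gy z"

definition hfun ::
  "((real^'n) \<times> (real^'p) \<Rightarrow> real) \<Rightarrow> real \<Rightarrow>
   ((real^'n) \<times> (real^'p) \<Rightarrow> real^'p^'p) \<Rightarrow> ((real^'n) \<times> (real^'p) \<Rightarrow> real^'p) \<Rightarrow>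
   (real^'n) \<times> (real^'p) \<Rightarrow> real" where
  "hfun f \<beta> Hyy gy z = f (fst z, Amap Hyy gy z) + \<beta> / 2 * (norm (gy z))\<^sup>2"

end

theory Submission
  imports Defs "HOL-Complex_Analysis.Great_Picard"
begin

text \<open>
  The iteration is an Euler discretisation of the differential inclusion \<open>z' \<in> - directions z\<close>, where
  \<open>directions z\<close> collects the update directions obtained from \<open>Df\<close> at \<open>(x, Amap (x, y))\<close>; it has closed
  convex values and closed graph, and \<open>0 \<in> directions z\<close> means that \<open>z\<close> is stationary.
  By the Arzela--Ascoli theorem the interpolated iterates, started at later and later times, subconverge
  to Lipschitz curves, and a separating hyperplane shows that wherever such a curve is differentiable it
  solves the inclusion.  Lipschitz curves are differentiable almost everywhere (a Vitali covering
  argument), so the potential property applies along \<open>(x, Amap (x, y))\<close> and shows that \<open>hfun\<close> strictly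
  decreases along every solution that starts at a nonstationary point.  If \<open>hfun\<close> oscillated along the
  interpolated curve, the curve would leave some noncritical level \<open>c\<close> upwards at arbitrarily late times
  and, by uniform continuity, stay above \<open>c\<close> for a fixed time; a limit of these pieces would be a
  solution started at a nonstationary point along which \<open>hfun\<close> does not decrease.
  Once \<open>hfun\<close> converges, it is constant along every limiting solution, so limit points are stationary.
\<close>

section \<open>Lipschitz functions of one real variable\<close>

abbreviation open_interval :: "real \<times> real \<Rightarrow> real set" where
  "open_interval i \<equiv> {fst i<..<snd i}"

abbreviation disjoint_intervals :: "(real \<times> real) set \<Rightarrow> bool" where
  "disjoint_intervals C \<equiv> pairwise (\<lambda>i j. disjnt (open_interval i) (open_interval j)) C"

definition vitali_cover :: "(real \<times> real) set \<Rightarrow> real set \<Rightarrow> bool" where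
  "vitali_cover K S \<longleftrightarrow> (\<forall>t\<in>S. \<forall>e>0. \<exists>a b. (a, b) \<in> K \<and> a < t \<and> t < b \<and> b - a < e)"

lemma vitali_coverD:
  assumes "vitali_cover K S" "t \<in> S" "0 < e"
  obtains a b where "(a, b) \<in> K" "a < t" "t < b" "b - a < e"
  using assms unfolding vitali_cover_def by blast

lemma vitali_cover_mono: "\<lbrakk>vitali_cover K S; K \<subseteq> L; T \<subseteq> S\<rbrakk> \<Longrightarrow> vitali_cover L T"
  unfolding vitali_cover_def by blast

definition flat_intervals :: "(real \<Rightarrow> real) \<Rightarrow> real \<Rightarrow> (real \<times> real) set" where
  "flat_intervals F p = {(a, b). F b - F a < p * (b - a)}"

definition steep_intervals :: "(real \<Rightarrow> real) \<Rightarrow> real \<Rightarrow> (real \<times> real) set" where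
  "steep_intervals F q = {(a, b). q * (b - a) < F b - F a}"

definition difference_quotient :: "(real \<Rightarrow> real) \<Rightarrow> real \<Rightarrow> real \<Rightarrow> real" where
  "difference_quotient F t s = (F s - F t) / (s - t)"

lemma vitali_cover_disjoint_subfamily:
  assumes K: "vitali_cover K S" and U: "open U" "S \<subseteq> U"
  obtains C where "countable C" "C \<subseteq> K" "\<And>i. i \<in> C \<Longrightarrow> fst i < snd i \<and> {fst i..snd i} \<subseteq> U"
    "disjoint_intervals C" "negligible (S - (\<Union>i\<in>C. open_interval i))"
proof -
  let ?K = "{i \<in> K. fst i < snd i \<and> {fst i..snd i} \<subseteq> U}"
  let ?c = "\<lambda>i::real \<times> real. (fst i + snd i) / 2" and ?r = "\<lambda>i::real \<times> real. (snd i - fst i) / 2"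
  have ball: "ball (?c i) (?r i) = open_interval i" for i
    by (simp add: greaterThanLessThan_eq_ball)
  have "\<exists>i. i \<in> ?K \<and> t \<in> open_interval i \<and> ?r i < e" if t: "t \<in> S" "0 < e" for t e
  proof -
    obtain r where r: "0 < r" "ball t r \<subseteq> U" using U t(1) openE by blast
    then obtain a b where ab: "(a, b) \<in> K" "a < t" "t < b" "b - a < min r e"
      using vitali_coverD[OF K t(1), of "min r e"] t(2) by auto
    then have "{a..b} \<subseteq> ball t r" by (auto simp: dist_real_def)
    then show ?thesis using ab r(2) by (intro exI[of _ "(a, b)"]) auto
  qed
  from Vitali_covering_theorem_balls[of S ?K ?c ?r, unfolded ball, OF this]
  obtain C where "countable C" "C \<subseteq> ?K" "disjoint_intervals C"
    "negligible (S - (\<Union>i\<in>C. open_interval i))" .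
  then show thesis by (intro that) auto
qed

lemma sum_increments_disjoint_intervals_le:
  fixes F :: "real \<Rightarrow> real"
  assumes "mono F" "finite C"
    and "\<And>i. i \<in> C \<Longrightarrow> c \<le> fst i \<and> fst i < snd i \<and> snd i \<le> d"
    and "disjoint_intervals C" and "c \<le> d"
  shows "(\<Sum>i\<in>C. F (snd i) - F (fst i)) \<le> F d - F c"
  using assms(2-)
proof (induction C arbitrary: d rule: finite_ranking_induct[where f = fst])
  case empty
  then show ?case using \<open>mono F\<close> by (simp add: monoD)
next
  case (insert i C)
  show ?case
  proof (cases "i \<in> C")
    case True
    then show ?thesis using insert.IH[of d] insert.prems by (simp add: insert_absorb)
  next
    case False
    have i: "c \<le> fst i" "fst i < snd i" "snd i \<le> d" using insert.prems(1)[of i] by simp_all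
    have "snd j \<le> fst i" if "j \<in> C" for j
    proof (rule ccontr)
      assume "\<not> snd j \<le> fst i"
      then have "(fst i + min (snd i) (snd j)) / 2 \<in> open_interval i \<inter> open_interval j"
        using insert.hyps(2)[OF that] insert.prems(1)[of j] that i by (auto simp: min_def)
      moreover have "disjnt (open_interval i) (open_interval j)"
        using insert.prems(2) that False unfolding pairwise_insert by metis
      ultimately show False by (auto simp: disjnt_def)
    qed
    then have "(\<Sum>j\<in>C. F (snd j) - F (fst j)) \<le> F (fst i) - F c"
      using insert.prems i by (intro insert.IH) (auto simp: pairwise_insert)
    then show ?thesis
      using insert.hyps(1) False monoD[OF \<open>mono F\<close> i(3)] by simp
  qed
qed

lemma measurable_hull_if_finite_outer_measure:
  fixes E :: "'a::euclidean_space set"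
  assumes "outer_measure_of lebesgue E < \<infinity>"
  obtains W where "W \<in> lmeasurable" "E \<subseteq> W" "outer_measure_of lebesgue E = ennreal (measure lebesgue W)"
proof -
  obtain W where W: "W \<in> sets lebesgue" "E \<subseteq> W" "outer_measure_of lebesgue E = emeasure lebesgue W"
    using outer_measure_of_attain[of E lebesgue] by auto
  then have "W \<in> lmeasurable" using assms by (intro fmeasurableI) auto
  then show thesis using that W by (simp add: emeasure_eq_measure2)
qed

lemma outer_measure_le_iff:
  fixes E :: "'a::euclidean_space set"
  assumes "0 \<le> B"
  shows "outer_measure_of lebesgue E \<le> ennreal B
    \<longleftrightarrow> (\<exists>W\<in>lmeasurable. E \<subseteq> W \<and> measure lebesgue W \<le> B)"
proof
  assume le: "outer_measure_of lebesgue E \<le> ennreal B"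
  then have finite: "outer_measure_of lebesgue E < \<infinity>"
    by (metis ennreal_less_top infinity_ennreal_def order_le_less_trans)
  obtain W where "W \<in> lmeasurable" "E \<subseteq> W" "outer_measure_of lebesgue E = ennreal (measure lebesgue W)"
    using measurable_hull_if_finite_outer_measure[OF finite] .
  with le assms show "\<exists>W\<in>lmeasurable. E \<subseteq> W \<and> measure lebesgue W \<le> B" by auto
next
  assume "\<exists>W\<in>lmeasurable. E \<subseteq> W \<and> measure lebesgue W \<le> B"
  then obtain W where W: "W \<in> lmeasurable" "E \<subseteq> W" "measure lebesgue W \<le> B" by blast
  have "outer_measure_of lebesgue E \<le> outer_measure_of lebesgue W"
    by (rule outer_measure_of_mono[OF W(2)])
  also have "\<dots> \<le> ennreal B" using W(1,3) by (simp add: emeasure_eq_measure2 fmeasurableD ennreal_leI)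
  finally show "outer_measure_of lebesgue E \<le> ennreal B" .
qed

lemma outer_measure_le_countable_pieces:
  fixes E :: "'a::euclidean_space set"
  assumes C: "countable C" and rest: "negligible (E - (\<Union>i\<in>C. I i))"
    and pieces: "\<And>i. i \<in> C \<Longrightarrow> outer_measure_of lebesgue (E \<inter> I i) \<le> ennreal (m i)" "\<And>i. i \<in> C \<Longrightarrow> 0 \<le> m i"
    and total: "\<And>D. \<lbrakk>D \<subseteq> C; finite D\<rbrakk> \<Longrightarrow> (\<Sum>i\<in>D. m i) \<le> B"
  shows "outer_measure_of lebesgue E \<le> ennreal B"
proof -
  have B: "0 \<le> B" using total[of "{}"] by simp
  have "\<exists>W\<in>lmeasurable. E \<inter> I i \<subseteq> W \<and> measure lebesgue W \<le> m i" if "i \<in> C" for i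
    using pieces that by (simp add: outer_measure_le_iff)
  then obtain W where W: "\<And>i. i \<in> C \<Longrightarrow> W i \<in> lmeasurable" "\<And>i. i \<in> C \<Longrightarrow> E \<inter> I i \<subseteq> W i"
    "\<And>i. i \<in> C \<Longrightarrow> measure lebesgue (W i) \<le> m i" by metis
  have finite_union: "measure lebesgue (\<Union>i\<in>D. W i) \<le> B" if D: "D \<subseteq> C" "finite D" for D
  proof -
    have "measure lebesgue (\<Union>i\<in>D. W i) \<le> (\<Sum>i\<in>D. measure lebesgue (W i))"
      by (rule measure_UNION_le) (use D W in \<open>auto simp: fmeasurableD\<close>)
    also have "\<dots> \<le> (\<Sum>i\<in>D. m i)" by (rule sum_mono) (use D W in auto)
    finally show ?thesis using total[OF D] by simp
  qed
  let ?N = "E - (\<Union>i\<in>C. I i)"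
  have N: "?N \<in> lmeasurable" "measure lebesgue ?N = 0"
    using rest by (auto simp: negligible_iff_measure)
  have union: "(\<Union>i\<in>C. W i) \<in> lmeasurable" "measure lebesgue (\<Union>i\<in>C. W i) \<le> B"
    by (rule fmeasurable_UN_bound[OF C W(1) finite_union]
        measure_UN_bound[OF C W(1) finite_union]; assumption)+
  have "measure lebesgue ((\<Union>i\<in>C. W i) \<union> ?N) \<le> measure lebesgue (\<Union>i\<in>C. W i) + measure lebesgue ?N"
    using union N by (intro measure_Un_le) (auto simp: fmeasurableD)
  moreover have "E \<subseteq> (\<Union>i\<in>C. W i) \<union> ?N" using W(2) by blast
  ultimately show ?thesis
    using fmeasurable.Un[OF union(1) N(1)] union(2) N(2)
    unfolding outer_measure_le_iff[OF B] by (metis add.right_neutral order_trans)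
qed

lemma outer_measure_steep_le:
  fixes F :: "real \<Rightarrow> real"
  assumes F: "mono F" and q: "0 < q" and E: "E \<subseteq> {c<..<d}" and "c \<le> d"
    and steep: "vitali_cover (steep_intervals F q) E"
  shows "outer_measure_of lebesgue E \<le> ennreal ((F d - F c) / q)"
proof -
  obtain C where C: "countable C" "C \<subseteq> steep_intervals F q"
    "\<And>i. i \<in> C \<Longrightarrow> fst i < snd i \<and> {fst i..snd i} \<subseteq> {c<..<d}"
    "disjoint_intervals C" "negligible (E - (\<Union>i\<in>C. open_interval i))"
    using vitali_cover_disjoint_subfamily[OF steep open_greaterThanLessThan E] by blast
  have bounds: "c \<le> fst i \<and> fst i < snd i \<and> snd i \<le> d" if "i \<in> C" for i
  proof -
    have "fst i \<in> {fst i..snd i}" "snd i \<in> {fst i..snd i}" using C(3)[OF that] by auto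
    then show ?thesis using C(3)[OF that] by fastforce
  qed
  show ?thesis
  proof (rule outer_measure_le_countable_pieces[OF C(1) C(5)])
    fix i assume i: "i \<in> C"
    have "outer_measure_of lebesgue (E \<inter> open_interval i) \<le> outer_measure_of lebesgue (open_interval i)"
      by (intro outer_measure_of_mono) blast
    then show "outer_measure_of lebesgue (E \<inter> open_interval i) \<le> ennreal (snd i - fst i)"
      using bounds[OF i] by simp
    show "0 \<le> snd i - fst i" using bounds[OF i] by simp
  next
    fix D assume D: "D \<subseteq> C" "finite D"
    have "(\<Sum>i\<in>D. snd i - fst i) \<le> (\<Sum>i\<in>D. F (snd i) - F (fst i)) / q"
      unfolding sum_divide_distrib
      by (rule sum_mono)
        (use C(2) D q in \<open>force simp: steep_intervals_def pos_le_divide_eq mult.commute\<close>)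
    also have "\<dots> \<le> (F d - F c) / q"
      using D bounds q \<open>c \<le> d\<close> pairwise_subset[OF C(4)]
      by (intro divide_right_mono sum_increments_disjoint_intervals_le F) auto
    finally show "(\<Sum>i\<in>D. snd i - fst i) \<le> (F d - F c) / q" .
  qed
qed

lemma outer_measure_flat_steep_le:
  fixes F :: "real \<Rightarrow> real"
  assumes F: "mono F" and pq: "0 \<le> p" "0 < q" and U: "open U" "E \<subseteq> U" "U \<in> lmeasurable"
    and flat: "vitali_cover (flat_intervals F p) E"
    and steep: "vitali_cover (steep_intervals F q) E"
  shows "outer_measure_of lebesgue E \<le> ennreal (p / q * measure lebesgue U)"
proof -
  obtain C where C: "countable C" "C \<subseteq> flat_intervals F p"
    "\<And>i. i \<in> C \<Longrightarrow> fst i < snd i \<and> {fst i..snd i} \<subseteq> U"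
    "disjoint_intervals C" "negligible (E - (\<Union>i\<in>C. open_interval i))"
    using vitali_cover_disjoint_subfamily[OF flat U(1,2)] by blast
  show ?thesis
  proof (rule outer_measure_le_countable_pieces[OF C(1) C(5)])
    fix i assume i: "i \<in> C"
    show "outer_measure_of lebesgue (E \<inter> open_interval i) \<le> ennreal ((F (snd i) - F (fst i)) / q)"
      using C(3)[OF i] by (intro outer_measure_steep_le F pq vitali_cover_mono[OF steep]) auto
    show "0 \<le> (F (snd i) - F (fst i)) / q"
      using C(3)[OF i] monoD[OF F, of "fst i" "snd i"] pq by simp
  next
    fix D assume D: "D \<subseteq> C" "finite D"
    have "(\<Sum>i\<in>D. (F (snd i) - F (fst i)) / q) \<le> (\<Sum>i\<in>D. p / q * measure lebesgue (open_interval i))"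
    proof (rule sum_mono)
      fix i assume "i \<in> D"
      then have "i \<in> C" using D by auto
      then have "(F (snd i) - F (fst i)) / q \<le> p * (snd i - fst i) / q"
        using C(2) pq by (intro divide_right_mono) (auto simp: flat_intervals_def)
      then show "(F (snd i) - F (fst i)) / q \<le> p / q * measure lebesgue (open_interval i)"
        using C(3)[OF \<open>i \<in> C\<close>] by simp
    qed
    also have "\<dots> = p / q * measure lebesgue (\<Union>i\<in>D. open_interval i)"
      unfolding sum_distrib_left[symmetric]
      by (subst measure_UNION') (use D in \<open>auto intro: pairwise_subset[OF C(4)] simp: fmeasurableD\<close>)
    also have "\<dots> \<le> p / q * measure lebesgue U"
      using C(3) D pq U(3)
      by (intro mult_left_mono measure_mono_fmeasurable) (force intro!: sets.finite_UN)+
    finally show "(\<Sum>i\<in>D. (F (snd i) - F (fst i)) / q) \<le> p / q * measure lebesgue U" .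
  qed
qed

lemma finite_outer_measure_if_bounded:
  fixes E :: "'a::euclidean_space set"
  assumes "bounded E"
  shows "outer_measure_of lebesgue E < \<infinity>"
proof -
  obtain r where "E \<subseteq> ball 0 r" using bounded_subset_ballD[OF assms, of 0] by metis
  then have "outer_measure_of lebesgue E \<le> outer_measure_of lebesgue (ball (0::'a) r)"
    by (rule outer_measure_of_mono)
  also have "\<dots> < \<infinity>"
    using fmeasurableD2[OF lmeasurable_ball, of 0 r] by (simp add: top.not_eq_extremum)
  finally show ?thesis .
qed

lemma lmeasurable_outer_open:
  fixes W :: "'a::euclidean_space set"
  assumes W: "W \<in> lmeasurable" and e: "0 < e"
  obtains U where "open U" "W \<subseteq> U" "U \<in> lmeasurable" "measure lebesgue U \<le> measure lebesgue W + e"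
proof -
  obtain U where U: "open U" "W \<subseteq> U" "U - W \<in> lmeasurable" "emeasure lebesgue (U - W) < ennreal e"
    by (rule sets_lebesgue_outer_open[OF fmeasurableD[OF W] e])
  have "U \<in> lmeasurable"
    using fmeasurable.Un[OF W U(3)] U(2) by (metis Diff_partition)
  moreover have "measure lebesgue U \<le> measure lebesgue W + measure lebesgue (U - W)"
    using measure_Un_le[of W lebesgue "U - W"] U W by (metis Diff_partition fmeasurableD)
  moreover have "measure lebesgue (U - W) < e"
    using U(3,4) e by (simp add: emeasure_eq_measure2 ennreal_less_iff)
  ultimately show thesis using that[OF U(1,2)] by linarith
qed

lemma negligible_flat_steep:
  fixes F :: "real \<Rightarrow> real"
  assumes F: "mono F" and pq: "0 \<le> p" "p < q" and "bounded E"
    and flat: "vitali_cover (flat_intervals F p) E"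
    and steep: "vitali_cover (steep_intervals F q) E"
  shows "negligible E"
proof -
  have q: "0 < q" using pq by simp
  obtain W where W: "W \<in> lmeasurable" "E \<subseteq> W" "outer_measure_of lebesgue E = ennreal (measure lebesgue W)"
    using measurable_hull_if_finite_outer_measure[OF finite_outer_measure_if_bounded[OF \<open>bounded E\<close>]] .
  let ?m = "measure lebesgue W"
  have "?m \<le> p / q * ?m"
  proof (rule field_le_epsilon)
    fix e :: real assume e: "0 < e"
    obtain U where U: "open U" "W \<subseteq> U" "U \<in> lmeasurable" "measure lebesgue U \<le> ?m + e"
      using lmeasurable_outer_open[OF W(1) e] .
    have "?m \<le> p / q * measure lebesgue U"
      using outer_measure_flat_steep_le[OF F pq(1) q U(1) _ U(3) flat steep] W(2,3) U(2) pq q by simp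
    also have "\<dots> \<le> p / q * (?m + e)" using U(4) pq by (intro mult_left_mono) auto
    also have "\<dots> \<le> p / q * ?m + e"
      using e pq mult_right_mono[of "p / q" 1 e] by (simp add: distrib_left)
    finally show "?m \<le> p / q * ?m + e" .
  qed
  then have "(1 - p / q) * ?m \<le> 0" by (simp add: algebra_simps)
  then have "?m = 0" using pq by (simp add: mult_le_0_iff measure_le_0_iff)
  then have "negligible W" using W(1) by (simp add: negligible_iff_measure)
  then show ?thesis using W(2) negligible_subset by blast
qed

lemma vitali_cover_flat_intervals:
  assumes F: "continuous_on UNIV F"
  shows "vitali_cover (flat_intervals F p) {t. \<exists>\<^sub>F s in at t. difference_quotient F t s < p}"
  unfolding vitali_cover_def
proof (intro ballI allI impI)
  fix t e :: real
  assume t: "t \<in> {t. \<exists>\<^sub>F s in at t. difference_quotient F t s < p}" and e: "0 < e"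
  have "\<forall>\<^sub>F s in at t. s \<noteq> t \<and> dist s t < e / 2"
    using e by (auto simp: eventually_at intro!: exI[of _ "e / 2"])
  with t have "\<exists>\<^sub>F s in at t. difference_quotient F t s < p \<and> s \<noteq> t \<and> dist s t < e / 2"
    using frequently_eventually_frequently[of "\<lambda>s. difference_quotient F t s < p" "at t"] by simp
  then obtain s where s: "difference_quotient F t s < p" "s \<noteq> t" "dist s t < e / 2"
    by (blast dest: frequently_ex)
  have "((\<lambda>u. difference_quotient F u s) \<longlongrightarrow> difference_quotient F t s) (at t)"
    using F s(2) unfolding difference_quotient_def
    by (intro tendsto_intros) (auto simp: continuous_on_eq_continuous_at isCont_def)
  then have "\<forall>\<^sub>F u in at t. difference_quotient F u s < p"
    using s(1) by (rule order_tendstoD(2))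
  then obtain r where r: "0 < r" "\<And>u. \<lbrakk>u \<noteq> t; dist u t < r\<rbrakk> \<Longrightarrow> (F s - F u) / (s - u) < p"
    by (auto simp: eventually_at difference_quotient_def)
  define \<delta> where "\<delta> = min r (e / 2) / 2"
  have \<delta>: "0 < \<delta>" "\<delta> < r" "\<delta> < e / 2" using r(1) e by (auto simp: \<delta>_def)
  show "\<exists>a b. (a, b) \<in> flat_intervals F p \<and> a < t \<and> t < b \<and> b - a < e"
  proof (cases "t < s")
    case True
    then show ?thesis using s(3) r(2)[of "t - \<delta>"] \<delta>
      by (intro exI[of _ "t - \<delta>"] exI[of _ s])
        (auto simp: flat_intervals_def dist_real_def pos_divide_less_eq)
  next
    case False
    then show ?thesis using s(2,3) r(2)[of "t + \<delta>"] \<delta>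
      by (intro exI[of _ s] exI[of _ "t + \<delta>"])
        (auto simp: flat_intervals_def dist_real_def neg_divide_less_eq algebra_simps)
  qed
qed

lemma vitali_cover_steep_intervals:
  assumes F: "continuous_on UNIV F"
  shows "vitali_cover (steep_intervals F q) {t. \<exists>\<^sub>F s in at t. q < difference_quotient F t s}"
proof -
  have "difference_quotient (\<lambda>t. - F t) t s = - difference_quotient F t s" for t s
    by (simp add: difference_quotient_def minus_divide_left)
  moreover have "flat_intervals (\<lambda>t. - F t) (- q) = steep_intervals F q"
    by (auto simp: flat_intervals_def steep_intervals_def)
  ultimately show ?thesis
    using vitali_cover_flat_intervals[OF continuous_on_minus[OF F], of "- q"] by simp
qed

lemma negligible_oscillating_difference_quotient:
  assumes F: "mono F" "continuous_on UNIV F" and pq: "0 \<le> p" "p < q"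
  shows "negligible {t. (\<exists>\<^sub>F s in at t. difference_quotient F t s < p)
    \<and> (\<exists>\<^sub>F s in at t. q < difference_quotient F t s)}" (is "negligible ?E")
  unfolding negligible_on_intervals[of ?E]
proof (intro allI negligible_flat_steep[OF F(1) pq])
  fix a b :: real
  show "bounded (?E \<inter> cbox a b)" using bounded_cbox by blast
  show "vitali_cover (flat_intervals F p) (?E \<inter> cbox a b)"
    by (rule vitali_cover_mono[OF vitali_cover_flat_intervals[OF F(2)]]) auto
  show "vitali_cover (steep_intervals F q) (?E \<inter> cbox a b)"
    by (rule vitali_cover_mono[OF vitali_cover_steep_intervals[OF F(2)]]) auto
qed

lemma frequently_oscillates_if_no_limit:
  fixes f :: "'b \<Rightarrow> real"
  assumes F: "F \<noteq> bot" and bound: "\<forall>\<^sub>F x in F. \<bar>f x\<bar> \<le> L" and no_limit: "\<nexists>c. (f \<longlongrightarrow> c) F"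
  obtains p q where "p < q" "\<exists>\<^sub>F x in F. f x < p" "\<exists>\<^sub>F x in F. q < f x"
proof -
  let ?l = "Liminf F (\<lambda>x. ereal (f x))" and ?u = "Limsup F (\<lambda>x. ereal (f x))"
  have "ereal (- L) \<le> ?l"
    using bound by (intro Liminf_bounded) (auto elim!: eventually_mono)
  moreover have "?u \<le> ereal L"
    using bound by (intro Limsup_bounded) (auto elim!: eventually_mono)
  ultimately have "?l \<noteq> ?u"
  proof (intro notI)
    assume eq: "?l = ?u" and "ereal (- L) \<le> ?l" "?u \<le> ereal L"
    then have "ereal (- L) \<le> ?l" "?l \<le> ereal L" by simp_all
    then have "\<bar>?l\<bar> \<noteq> \<infinity>" by auto
    then obtain c where "?l = ereal c" using ereal_real' by metis
    then have "((\<lambda>x. ereal (f x)) \<longlongrightarrow> ereal c) F" using eq by (intro Liminf_eq_Limsup F) auto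
    then show False using no_limit by auto
  qed
  then have "?l < ?u" using Liminf_le_Limsup[OF F, of "\<lambda>x. ereal (f x)"] by simp
  then obtain p where p: "?l < ereal p" "ereal p < ?u" using ereal_dense2 by blast
  then obtain q where q: "p < q" "ereal q < ?u" using ereal_dense2[OF p(2)] by auto
  show thesis
  proof (rule that[OF q(1)])
    show "\<exists>\<^sub>F x in F. f x < p"
    proof (rule ccontr)
      assume "\<not> ?thesis"
      then have "ereal p \<le> ?l" by (intro Liminf_bounded) (simp add: not_frequently not_less)
      then show False using p(1) by simp
    qed
    show "\<exists>\<^sub>F x in F. q < f x"
    proof (rule ccontr)
      assume "\<not> ?thesis"
      then have "?u \<le> ereal q" by (intro Limsup_bounded) (simp add: not_frequently not_less)
      then show False using q(2) by simp
    qed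
  qed
qed

lemma abs_difference_quotient_le_lipschitz:
  assumes "L-lipschitz_on UNIV F" shows "\<bar>difference_quotient F t s\<bar> \<le> L"
  using lipschitz_onD[OF assms, of s t] lipschitz_on_nonneg[OF assms]
  by (auto simp: difference_quotient_def dist_real_def abs_divide divide_le_eq)

lemma difference_quotient_tendsto_derivative:
  assumes "(F has_real_derivative D) (at t)" "filterlim h (at 0) A"
  shows "((\<lambda>n. difference_quotient F t (t + h n)) \<longlongrightarrow> D) A"
  using filterlim_compose[of "\<lambda>u. (F (t + u) - F t) / u" "nhds D" "at 0" h A] assms
  by (simp add: difference_quotient_def DERIV_def)

lemma difference_quotient_nonneg:
  assumes "mono F" shows "0 \<le> difference_quotient F t s"
  using monoD[OF assms, of s t] monoD[OF assms, of t s]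
  by (cases "s \<le> t") (auto simp: difference_quotient_def divide_nonpos_nonpos)

lemma mono_lipschitz_differentiable_ae:
  fixes F :: "real \<Rightarrow> real"
  assumes mono: "mono F" and lip: "L-lipschitz_on UNIV F"
  shows "negligible {t. \<not> F differentiable (at t)}"
proof -
  let ?Q = "difference_quotient F"
  define E where "E p q = {t. (\<exists>\<^sub>F s in at t. ?Q t s < real_of_rat p)
    \<and> (\<exists>\<^sub>F s in at t. real_of_rat q < ?Q t s)}" for p q
  let ?I = "{(p, q). 0 \<le> p \<and> p < q}"
  have "{t. \<not> F differentiable (at t)} \<subseteq> (\<Union>(p, q)\<in>?I. E p q)"
  proof
    fix t assume "t \<in> {t. \<not> F differentiable (at t)}"
    then have "\<nexists>c. (?Q t \<longlongrightarrow> c) (at t)"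
      by (simp add: real_differentiable_def has_field_derivative_iff difference_quotient_def[abs_def])
    moreover have "\<forall>\<^sub>F s in at t. \<bar>?Q t s\<bar> \<le> L"
      using abs_difference_quotient_le_lipschitz[OF lip] by simp
    ultimately obtain l u where lu: "l < u" "\<exists>\<^sub>F s in at t. ?Q t s < l" "\<exists>\<^sub>F s in at t. u < ?Q t s"
      using frequently_oscillates_if_no_limit[OF at_neq_bot] by blast
    obtain p where p: "l < real_of_rat p" "real_of_rat p < u" using of_rat_dense[OF lu(1)] by blast
    obtain q where q: "real_of_rat p < real_of_rat q" "real_of_rat q < u"
      using of_rat_dense[OF p(2)] by blast
    have freq: "\<exists>\<^sub>F s in at t. ?Q t s < real_of_rat p" "\<exists>\<^sub>F s in at t. real_of_rat q < ?Q t s"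
      using lu(2,3) p(1) q(2) by (auto elim: frequently_elim1)
    obtain s where "?Q t s < real_of_rat p" using freq(1) by (auto dest: frequently_ex)
    then have "0 < real_of_rat p" using difference_quotient_nonneg[OF mono] order_le_less_trans by blast
    then have "(p, q) \<in> ?I" using q(1) by (simp add: of_rat_less)
    then show "t \<in> (\<Union>(p, q)\<in>?I. E p q)" using freq by (auto simp: E_def)
  qed
  moreover have "negligible (\<Union>(p, q)\<in>?I. E p q)"
    using negligible_oscillating_difference_quotient[OF mono lipschitz_on_continuous_on[OF lip]]
    by (intro negligible_countable_Union) (auto simp: E_def of_rat_less)
  ultimately show ?thesis by (rule negligible_subset[rotated])
qed

lemma lipschitz_real_differentiable_ae:
  fixes F :: "real \<Rightarrow> real"
  assumes lip: "L-lipschitz_on UNIV F"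
  shows "negligible {t. \<not> F differentiable (at t)}"
proof -
  have "mono (\<lambda>t. F t + L * t)"
  proof (rule monoI)
    fix s t :: real assume "s \<le> t"
    then show "F s + L * s \<le> F t + L * t"
      using lipschitz_onD[OF lip, of t s] by (simp add: dist_real_def algebra_simps abs_le_iff)
  qed
  moreover have "(L + L * 1)-lipschitz_on UNIV (\<lambda>t. F t + L * t)"
    by (intro lipschitz_intros lip lipschitz_on_nonneg[OF lip])
  ultimately have "negligible {t. \<not> (\<lambda>t. F t + L * t) differentiable (at t)}"
    by (rule mono_lipschitz_differentiable_ae)
  moreover have "F differentiable (at t)" if "(\<lambda>t. F t + L * t) differentiable (at t)" for t
  proof -
    have "(\<lambda>s. (F s + L * s) - L * s) differentiable (at t)" by (intro derivative_intros that)
    then show ?thesis by simp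
  qed
  ultimately show ?thesis by (auto elim!: negligible_subset)
qed

theorem lipschitz_differentiable_ae:
  fixes F :: "real \<Rightarrow> 'a::euclidean_space"
  assumes lip: "L-lipschitz_on UNIV F"
  shows "negligible {t. \<not> F differentiable (at t)}"
proof -
  have "negligible {t. \<not> (\<lambda>s. F s \<bullet> b) differentiable (at t)}" if "b \<in> Basis" for b
  proof (rule lipschitz_real_differentiable_ae, rule lipschitz_onI[OF _ lipschitz_on_nonneg[OF lip]])
    fix s t
    have "dist (F s \<bullet> b) (F t \<bullet> b) \<le> dist (F s) (F t)"
      using Basis_le_norm[OF that, of "F s - F t"] by (simp add: dist_norm inner_diff_left)
    then show "dist (F s \<bullet> b) (F t \<bullet> b) \<le> L * dist s t" using lipschitz_onD[OF lip, of s t] by simp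
  qed
  then have "negligible (\<Union>b\<in>Basis. {t. \<not> (\<lambda>s. F s \<bullet> b) differentiable (at t)})"
    by (intro negligible_Union) auto
  then show ?thesis
    by (rule negligible_subset) (auto simp: differentiable_componentwise_within[of F])
qed

lemma difference_quotient_integral_tendsto:
  assumes F: "continuous_on UNIV F" and "a \<le> b" and h: "filterlim h (at_right 0) sequentially"
  shows "(\<lambda>n. integral {a..b} (\<lambda>t. difference_quotient F t (t + h n))) \<longlonglongrightarrow> F b - F a"
proof -
  have h_lim: "h \<longlonglongrightarrow> 0" "filterlim h (at 0) sequentially" and h_pos: "\<forall>\<^sub>F n in sequentially. 0 < h n"
    using h by (auto simp: filterlim_at elim: eventually_mono)
  obtain I where I: "\<And>x. x \<in> {a - 1..b + 2} \<Longrightarrow> (I has_vector_derivative F x) (at x within {a - 1..b + 2})"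
    using antiderivative_continuous[OF continuous_on_subset[OF F]] by (metis subset_UNIV)
  have I_deriv: "(I has_real_derivative F x) (at x)" if "a \<le> x" "x \<le> b + 1" for x
  proof -
    have "at x within {a - 1..b + 2} = at x" using that by (intro at_within_interior) simp
    then show ?thesis using I[of x] that by (simp add: has_real_derivative_iff_has_vector_derivative)
  qed
  let ?Q = "\<lambda>n x. difference_quotient I x (x + h n)"
  have "(\<lambda>n. ?Q n b - ?Q n a) \<longlonglongrightarrow> F b - F a"
    using \<open>a \<le> b\<close> by (intro tendsto_diff difference_quotient_tendsto_derivative I_deriv h_lim(2)) auto
  moreover have "\<forall>\<^sub>F n in sequentially. h n < 1" using order_tendstoD(2)[OF h_lim(1)] by simp
  then have "\<forall>\<^sub>F n in sequentially.
      ?Q n b - ?Q n a = integral {a..b} (\<lambda>t. difference_quotient F t (t + h n))"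
    using h_pos
  proof eventually_elim
    case (elim n)
    have "(?Q n has_vector_derivative difference_quotient F t (t + h n)) (at t within {a..b})"
      if "t \<in> {a..b}" for t
      unfolding has_real_derivative_iff_has_vector_derivative[symmetric]
        difference_quotient_def add_diff_cancel_left'
      by (rule has_field_derivative_at_within)
        (rule derivative_eq_intros DERIV_shift[THEN iffD1] I_deriv refl | use that elim in simp)+
    from integral_unique[OF fundamental_theorem_of_calculus[OF \<open>a \<le> b\<close> this]] show ?case by simp
  qed
  ultimately show ?thesis by (rule Lim_transform_eventually)
qed

theorem lipschitz_has_integral_derivative:
  fixes F :: "real \<Rightarrow> real"
  assumes lip: "L-lipschitz_on UNIV F" and "a \<le> b" and N: "negligible N"
    and der: "\<And>t. t \<in> {a..b} - N \<Longrightarrow> (F has_real_derivative F' t) (at t)"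
  shows "(F' has_integral (F b - F a)) {a..b}"
proof -
  have cont: "continuous_on UNIV F" using lipschitz_on_continuous_on[OF lip] .
  define h where "h n = inverse (real (Suc n))" for n
  have "filterlim h (at_right 0) sequentially"
    unfolding h_def filterlim_at using LIMSEQ_inverse_real_of_nat by (simp add: eventually_sequentially)
  then have h: "filterlim h (at_right 0) sequentially" "filterlim h (at 0) sequentially"
    by (auto simp: filterlim_at elim: eventually_mono)
  have pos: "0 < h n" for n by (simp add: h_def)
  define Q where "Q n t = difference_quotient F t (t + h n)" for n t
  define restrict where "restrict \<phi> t = (if t \<in> N then 0 else \<phi> t)" for \<phi> :: "real \<Rightarrow> real" and t
  have "Q n integrable_on {a..b}" for n
    unfolding Q_def difference_quotient_def using pos[of n]
    by (intro integrable_continuous_interval continuous_intros continuous_on_compose2[OF cont]) auto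
  then have restrict_Q: "restrict (Q n) integrable_on {a..b}"
    "integral {a..b} (restrict (Q n)) = integral {a..b} (Q n)" for n
    using integrable_spike[of "Q n" "{a..b}" N "restrict (Q n)"]
      integral_spike[of N "{a..b}" "Q n" "restrict (Q n)"] N
    by (simp_all add: restrict_def)
  have bound: "norm (restrict (Q n) t) \<le> L" for n t
    using abs_difference_quotient_le_lipschitz[OF lip] lipschitz_on_nonneg[OF lip]
    by (simp add: restrict_def Q_def)
  have lim: "(\<lambda>n. restrict (Q n) t) \<longlonglongrightarrow> restrict F' t" if "t \<in> {a..b}" for t
    using difference_quotient_tendsto_derivative[OF der h(2), of t] that
    by (simp add: restrict_def Q_def)
  note dominated = dominated_convergence[of "\<lambda>n. restrict (Q n)" "{a..b}" "\<lambda>_. L" "restrict F'",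
      OF restrict_Q(1) integrable_const_ivl bound lim]
  have "(\<lambda>n. integral {a..b} (restrict (Q n))) \<longlonglongrightarrow> F b - F a"
    unfolding restrict_Q(2) Q_def by (rule difference_quotient_integral_tendsto[OF cont \<open>a \<le> b\<close> h(1)])
  then have "integral {a..b} (restrict F') = F b - F a" using dominated(2) LIMSEQ_unique by blast
  then have "(restrict F' has_integral (F b - F a)) {a..b}"
    using dominated(1) by (metis integrable_integral)
  then show ?thesis
    by (rule has_integral_spike[OF N, rotated]) (auto simp: restrict_def)
qed

lemma has_integral_pos_ae:
  fixes f :: "'a::euclidean_space \<Rightarrow> real"
  assumes int: "(f has_integral i) S" and N: "negligible N" and nonneg: "\<And>x. x \<in> S - N \<Longrightarrow> 0 \<le> f x"
    and U: "U \<subseteq> S" "\<not> negligible U" and pos: "\<And>x. x \<in> U - N \<Longrightarrow> 0 < f x"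
  shows "0 < i"
proof -
  define g where "g x = (if x \<in> N then 0 else f x)" for x
  have g: "(g has_integral i) S" by (rule has_integral_spike[OF N _ int]) (simp add: g_def)
  have g0: "0 \<le> g x" if "x \<in> S" for x using nonneg that by (simp add: g_def)
  have "i \<noteq> 0"
  proof
    assume "i = 0"
    have abs_int: "g absolutely_integrable_on S"
      using g g0 by (intro nonnegative_absolutely_integrable_1) auto
    then have "(LINT x:S|lebesgue. g x) = 0"
      using set_lebesgue_integral_eq_integral(2) integral_unique[OF g] \<open>i = 0\<close> by metis
    then have "AE x in lebesgue. indicator S x *\<^sub>R g x = 0"
      using abs_int g0 unfolding set_lebesgue_integral_def set_integrable_def
      by (subst (asm) integral_nonneg_eq_0_iff_AE) (auto simp: indicator_def)
    then obtain M where M: "M \<in> null_sets lebesgue" "{x. indicator S x *\<^sub>R g x \<noteq> 0} \<subseteq> M"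
      by (auto simp: eventually_ae_filter)
    have "U \<subseteq> N \<union> M"
    proof
      fix x assume "x \<in> U"
      then have "x \<in> N \<or> indicator S x *\<^sub>R g x \<noteq> 0" using U(1) pos[of x] by (auto simp: g_def)
      then show "x \<in> N \<union> M" using M(2) by blast
    qed
    then show False using U(2) N M(1) negligible_Un negligible_subset negligible_iff_null_sets by blast
  qed
  then show ?thesis using has_integral_nonneg[OF g g0] by simp
qed

lemma lipschitz_imp_abs_cont_01:
  assumes lip: "K-lipschitz_on {0..1} \<gamma>"
  shows "abs_cont_01 \<gamma>"
  unfolding abs_cont_01_def
proof (intro allI impI)
  fix \<epsilon> :: real assume \<epsilon>: "0 < \<epsilon>"
  have K: "0 \<le> K" using lipschitz_on_nonneg[OF lip] .
  show "\<exists>\<delta>>0. \<forall>S :: (real \<times> real) set.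
        finite S \<longrightarrow> (\<forall>(a,b)\<in>S. 0 \<le> a \<and> a < b \<and> b \<le> 1) \<longrightarrow>
        (\<forall>(a,b)\<in>S. \<forall>(c,d)\<in>S. (a,b) \<noteq> (c,d) \<longrightarrow> {a<..<b} \<inter> {c<..<d} = {}) \<longrightarrow>
        (\<Sum>(a,b)\<in>S. b - a) < \<delta> \<longrightarrow> (\<Sum>(a,b)\<in>S. norm (\<gamma> b - \<gamma> a)) < \<epsilon>"
  proof (intro exI[of _ "\<epsilon> / (K + 1)"] conjI allI impI)
    show "0 < \<epsilon> / (K + 1)" using \<epsilon> K by simp
    fix S :: "(real \<times> real) set"
    assume S: "\<forall>(a,b)\<in>S. 0 \<le> a \<and> a < b \<and> b \<le> 1" "(\<Sum>(a,b)\<in>S. b - a) < \<epsilon> / (K + 1)"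
    have "(\<Sum>(a,b)\<in>S. norm (\<gamma> b - \<gamma> a)) \<le> (\<Sum>(a,b)\<in>S. K * (b - a))"
    proof (rule sum_mono, clarify)
      fix a b assume "(a, b) \<in> S"
      then show "norm (\<gamma> b - \<gamma> a) \<le> K * (b - a)"
        using S(1) lipschitz_on_normD[OF lip, of b a] by force
    qed
    also have "\<dots> = K * (\<Sum>(a,b)\<in>S. b - a)" by (simp add: sum_distrib_left case_prod_beta)
    also have "\<dots> \<le> K * (\<epsilon> / (K + 1))" using S(2) K by (intro mult_left_mono) auto
    also have "\<dots> < \<epsilon>" using \<epsilon> K by (simp add: field_simps)
    finally show "(\<Sum>(a,b)\<in>S. norm (\<gamma> b - \<gamma> a)) < \<epsilon>" .
  qed
qed

section \<open>Trajectories of differential inclusions\<close>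

text \<open>Lipschitz curves are differentiable almost everywhere, so the second condition says that
  \<open>\<gamma>' \<in> - G \<gamma>\<close> almost everywhere.\<close>
definition descent_trajectory :: "('a::euclidean_space \<Rightarrow> 'a set) \<Rightarrow> real \<Rightarrow> (real \<Rightarrow> 'a) \<Rightarrow> bool" where
  "descent_trajectory G T \<gamma> \<longleftrightarrow> (\<exists>L. L-lipschitz_on {0..T} \<gamma>)
    \<and> (\<forall>t\<in>{0<..<T}. \<forall>u. (\<gamma> has_vector_derivative u) (at t) \<longrightarrow> - u \<in> G (\<gamma> t))"

locale asymptotic_trajectory =
  fixes X :: "real \<Rightarrow> 'a::euclidean_space" and G :: "'a \<Rightarrow> 'a set"
  assumes X_lipschitz: "\<exists>L. L-lipschitz_on {0..} X"
    and X_bounded: "bounded (X ` {0..})"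
    and limit_trajectory: "\<And>t T. \<lbrakk>filterlim t at_top sequentially; 0 < T\<rbrakk> \<Longrightarrow>
      \<exists>\<gamma> r. strict_mono (r :: nat \<Rightarrow> nat) \<and> descent_trajectory G T \<gamma> \<and>
        (\<forall>s\<in>{0..T}. (\<lambda>j. X (t (r j) + s)) \<longlonglongrightarrow> \<gamma> s)"

locale lyapunov_trajectory = asymptotic_trajectory X G
  for X :: "real \<Rightarrow> 'a::euclidean_space" and G +
  fixes h :: "'a \<Rightarrow> real" and S :: "'a set"
  assumes h_continuous: "continuous_on UNIV h"
    and h_decreases: "\<And>\<gamma> T. \<lbrakk>0 < T; descent_trajectory G T \<gamma>; \<gamma> 0 \<notin> S\<rbrakk> \<Longrightarrow> h (\<gamma> T) < h (\<gamma> 0)"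
    and critical_values: "interior (h ` S) = {}"

lemma last_passage:
  fixes f :: "real \<Rightarrow> real"
  assumes f: "continuous_on {a..b} f" and "a \<le> b" "f a \<le> c" "c \<le> f b"
  obtains \<tau> where "\<tau> \<in> {a..b}" "f \<tau> = c" "\<And>s. s \<in> {\<tau>..b} \<Longrightarrow> c \<le> f s"
proof -
  let ?S = "{s \<in> {a..b}. f s \<le> c}"
  have "compact ?S"
    using continuous_closed_preimage[OF f closed_atLeastAtMost closed_atMost, of c]
    by (auto simp: compact_eq_bounded_closed vimage_def Int_def intro: bounded_subset[of "{a..b}"])
  moreover have "a \<in> ?S" using assms by simp
  ultimately obtain \<tau> where \<tau>: "\<tau> \<in> ?S" "\<And>s. s \<in> ?S \<Longrightarrow> s \<le> \<tau>"
    using compact_attains_sup[of ?S] by blast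
  have "continuous_on {\<tau>..b} f" by (rule continuous_on_subset[OF f]) (use \<tau>(1) in auto)
  then obtain s where s: "\<tau> \<le> s" "s \<le> b" "f s = c"
    using IVT'[of f \<tau> c b] \<tau>(1) \<open>c \<le> f b\<close> by auto
  then have "s = \<tau>" using \<tau> by (intro antisym) auto
  moreover have "c \<le> f s'" if "s' \<in> {\<tau>..b}" for s'
  proof (rule ccontr)
    assume "\<not> c \<le> f s'"
    moreover from this have "s' = \<tau>" using \<tau>(1) \<tau>(2)[of s'] that by auto
    ultimately show False using s(3) \<open>s = \<tau>\<close> by simp
  qed
  ultimately show thesis using that[of \<tau>] \<tau>(1) s(3) by auto
qed

context lyapunov_trajectory
begin

lemma h_tendsto: "(f \<longlongrightarrow> p) F \<Longrightarrow> ((\<lambda>x. h (f x)) \<longlongrightarrow> h p) F"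
  by (rule continuous_on_tendsto_compose[OF h_continuous]) auto

lemma compact_closure_X: "compact (closure (X ` {0..}))"
  using X_bounded by simp

lemma h_X_uniformly_continuous: "uniformly_continuous_on {0..} (\<lambda>s. h (X s))"
proof -
  have "uniformly_continuous_on (closure (X ` {0..})) h"
    by (rule compact_uniformly_continuous[OF
          continuous_on_subset[OF h_continuous subset_UNIV] compact_closure_X])
  moreover have "X ` {0..} \<subseteq> closure (X ` {0..})" by (rule closure_subset)
  ultimately have "uniformly_continuous_on (X ` {0..}) h"
    unfolding uniformly_continuous_on_def by (meson subsetD)
  moreover have "uniformly_continuous_on {0..} X"
    using X_lipschitz by (auto intro: lipschitz_on_uniformly_continuous)
  ultimately show ?thesis
    using uniformly_continuous_on_compose[of "{0..}" X h] by simp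
qed

lemma h_X_bounded:
  obtains L where "\<And>s. 0 \<le> s \<Longrightarrow> \<bar>h (X s)\<bar> \<le> L"
proof -
  have "bounded (h ` closure (X ` {0..}))"
    by (intro compact_imp_bounded compact_continuous_image compact_closure_X
        continuous_on_subset[OF h_continuous]) simp
  then obtain L where "\<And>p. p \<in> closure (X ` {0..}) \<Longrightarrow> norm (h p) \<le> L"
    by (auto simp: bounded_iff)
  moreover have "X s \<in> closure (X ` {0..})" if "0 \<le> s" for s
    using that by (intro closure_subset[THEN subsetD]) auto
  ultimately show thesis using that[of L] by simp
qed

lemma slow_upcrossing:
  assumes low: "\<exists>\<^sub>F s in at_top. h (X s) < c" and high: "\<exists>\<^sub>F s in at_top. d < h (X s)" and "c < d"
  obtains T where "0 < T" "\<And>n. \<exists>\<tau>\<ge>n. h (X \<tau>) = c \<and> c \<le> h (X (\<tau> + T))"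
proof -
  have "0 < d - c" using \<open>c < d\<close> by simp
  then obtain \<delta> where \<delta>: "0 < \<delta>"
    "\<forall>s\<in>{0..}. \<forall>s'\<in>{0..}. dist s' s < \<delta> \<longrightarrow> dist (h (X s')) (h (X s)) < d - c"
    using h_X_uniformly_continuous unfolding uniformly_continuous_on_def by meson
  have "\<exists>\<tau>\<ge>n. h (X \<tau>) = c \<and> c \<le> h (X (\<tau> + \<delta> / 2))" for n
  proof -
    obtain a where a: "max 0 n \<le> a" "h (X a) < c"
      using frequently_ex[OF frequently_eventually_frequently[OF low eventually_ge_at_top[of "max 0 n"]]]
      by blast
    obtain b where b: "a \<le> b" "d < h (X b)"
      using frequently_ex[OF frequently_eventually_frequently[OF high eventually_ge_at_top[of a]]]
      by blast
    have "continuous_on {a..b} (\<lambda>s. h (X s))"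
      by (rule continuous_on_subset[OF uniformly_continuous_imp_continuous[OF h_X_uniformly_continuous]])
        (use a in auto)
    from last_passage[OF this b(1), of c] a b \<open>c < d\<close>
    obtain \<tau> where \<tau>: "\<tau> \<in> {a..b}" "h (X \<tau>) = c" "\<And>s. s \<in> {\<tau>..b} \<Longrightarrow> c \<le> h (X s)" by auto
    have "\<tau> + \<delta> / 2 \<le> b"
    proof (rule ccontr)
      assume "\<not> ?thesis"
      then have "dist b \<tau> < \<delta>" using \<tau>(1) \<delta>(1) by (auto simp: dist_real_def)
      then have "dist (h (X b)) (h (X \<tau>)) < d - c" using \<delta>(2) \<tau>(1) a(1) by auto
      then show False using \<tau>(2) b(2) by (auto simp: dist_real_def)
    qed
    then show ?thesis using \<tau> a(1) \<delta>(1) by (intro exI[of _ \<tau>]) auto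
  qed
  then show thesis using that[of "\<delta> / 2"] \<delta>(1) by simp
qed

theorem h_X_converges: "\<exists>c. ((\<lambda>s. h (X s)) \<longlongrightarrow> c) at_top"
proof (rule ccontr)
  assume no_limit: "\<not> ?thesis"
  obtain L where "\<And>s. 0 \<le> s \<Longrightarrow> \<bar>h (X s)\<bar> \<le> L" using h_X_bounded by blast
  then have "\<forall>\<^sub>F s in at_top. \<bar>h (X s)\<bar> \<le> L" by (intro eventually_mono[OF eventually_ge_at_top[of 0]])
  then obtain l u where lu: "l < u" "\<exists>\<^sub>F s in at_top. h (X s) < l" "\<exists>\<^sub>F s in at_top. u < h (X s)"
    using frequently_oscillates_if_no_limit[OF trivial_limit_at_top_linorder _ no_limit] by blast
  have "\<not> {l<..<u} \<subseteq> h ` S"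
    using critical_values interior_maximal[of "{l<..<u}" "h ` S"] lu(1) by auto
  then obtain c where "c \<in> {l<..<u}" "c \<notin> h ` S" by blast
  then have c: "l < c" "c < u" "c \<notin> h ` S" by simp_all
  have "\<exists>\<^sub>F s in at_top. h (X s) < c" using lu(2) c(1) by (auto elim: frequently_elim1)
  from slow_upcrossing[OF this lu(3) c(2)]
  obtain T where T: "0 < T" "\<And>n. \<exists>\<tau>\<ge>n. h (X \<tau>) = c \<and> c \<le> h (X (\<tau> + T))" by metis
  then have "\<exists>\<tau>\<ge>real n. h (X \<tau>) = c \<and> c \<le> h (X (\<tau> + T))" for n by blast
  then obtain \<tau> where \<tau>: "\<And>n. real n \<le> \<tau> n" "\<And>n. h (X (\<tau> n)) = c" "\<And>n. c \<le> h (X (\<tau> n + T))" by metis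
  have "filterlim \<tau> at_top sequentially"
    by (rule filterlim_at_top_mono[OF filterlim_real_sequentially]) (simp add: \<tau>(1))
  then obtain \<gamma> r where \<gamma>: "descent_trajectory G T \<gamma>"
    and lim: "\<And>s. s \<in> {0..T} \<Longrightarrow> (\<lambda>j. h (X (\<tau> (r j) + s))) \<longlonglongrightarrow> h (\<gamma> s)"
    using limit_trajectory[OF _ T(1)] h_tendsto by blast
  have start: "h (\<gamma> 0) = c" using lim[of 0] T(1) by (simp add: \<tau>(2) LIMSEQ_const_iff)
  moreover have "c \<le> h (\<gamma> T)"
    using lim[of T] T(1) \<tau>(3) by (intro tendsto_lowerbound[OF lim]) auto
  moreover have "\<gamma> 0 \<notin> S" using start c(3) by auto
  ultimately show False using h_decreases[OF T(1) \<gamma>] by simp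
qed

theorem limit_point_in_S:
  assumes t: "filterlim t at_top sequentially" and lim: "(\<lambda>j::nat. X (t j)) \<longlonglongrightarrow> p"
  shows "p \<in> S"
proof (rule ccontr)
  assume "p \<notin> S"
  obtain c where c: "((\<lambda>s. h (X s)) \<longlongrightarrow> c) at_top" using h_X_converges by blast
  obtain \<gamma> r where r: "strict_mono r" and \<gamma>: "descent_trajectory G 1 \<gamma>"
    and X_lim: "\<And>s. s \<in> {0..1} \<Longrightarrow> (\<lambda>j. X (t (r j) + s)) \<longlonglongrightarrow> \<gamma> s"
    using limit_trajectory[OF t zero_less_one] by blast
  have "(\<lambda>j. X (t (r j))) \<longlonglongrightarrow> p" using LIMSEQ_subseq_LIMSEQ[OF lim r] by (simp add: o_def)
  then have "\<gamma> 0 = p" using X_lim[of 0] LIMSEQ_unique by simp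
  moreover have h_constant: "h (\<gamma> s) = c" if "s \<in> {0..1}" for s
  proof (rule LIMSEQ_unique[OF h_tendsto[OF X_lim[OF that]]])
    have "filterlim (\<lambda>j. t (r j)) at_top sequentially"
      by (rule filterlim_compose[OF t filterlim_subseq[OF r]])
    then have "filterlim (\<lambda>j. t (r j) + s) at_top sequentially"
      by (rule filterlim_at_top_mono) (use that in auto)
    then show "(\<lambda>j. h (X (t (r j) + s))) \<longlonglongrightarrow> c" by (rule filterlim_compose[OF c])
  qed
  ultimately show False
    using h_decreases[OF zero_less_one \<gamma>] \<open>p \<notin> S\<close> h_constant[of 0] h_constant[of 1] by simp
qed

end

section \<open>Limit curves of Euler iterations\<close>

lemma uniformly_lipschitz_subsequence:
  fixes F :: "nat \<Rightarrow> 'a::euclidean_space \<Rightarrow> 'b::euclidean_space"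
  assumes "compact S" and lip: "\<And>n. L-lipschitz_on S (F n)" and bound: "\<And>n x. x \<in> S \<Longrightarrow> norm (F n x) \<le> M"
  shows "\<exists>g r. strict_mono (r :: nat \<Rightarrow> nat) \<and> L-lipschitz_on S g \<and> (\<forall>x\<in>S. (\<lambda>n. F (r n) x) \<longlonglongrightarrow> g x)"
proof -
  have L: "0 \<le> L" using lipschitz_on_nonneg[OF lip] .
  have equicontinuous: "\<exists>d. 0 < d \<and> (\<forall>n y. y \<in> S \<and> norm (x - y) < d \<longrightarrow> norm (F n x - F n y) < e)"
    if x: "x \<in> S" "0 < e" for x e
  proof (intro exI[of _ "e / (L + 1)"] conjI allI impI)
    show "0 < e / (L + 1)" using x L by simp
    fix n y assume y: "y \<in> S \<and> norm (x - y) < e / (L + 1)"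
    have "norm (F n x - F n y) \<le> L * norm (x - y)" using lipschitz_on_normD[OF lip] x y by blast
    also have "\<dots> \<le> L * (e / (L + 1))" using y L by (intro mult_left_mono) auto
    also have "\<dots> < e" using x L by (simp add: field_simps)
    finally show "norm (F n x - F n y) < e" .
  qed
  obtain g r where r: "strict_mono (r :: nat \<Rightarrow> nat)"
    and g: "\<And>e. 0 < e \<Longrightarrow> \<exists>N. \<forall>n x. n \<ge> N \<and> x \<in> S \<longrightarrow> norm (F (r n) x - g x) < e"
  proof (rule Arzela_Ascoli[of S F M])
    fix g and r :: "nat \<Rightarrow> nat"
    assume "strict_mono r"
      "\<And>e. 0 < e \<Longrightarrow> \<exists>N. \<forall>n x. n \<ge> N \<and> x \<in> S \<longrightarrow> norm (F (r n) x - g x) < e"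
    then show thesis by (rule that)
  qed (use \<open>compact S\<close> bound equicontinuous in auto)
  have lim: "(\<lambda>n. F (r n) x) \<longlonglongrightarrow> g x" if "x \<in> S" for x
    unfolding LIMSEQ_iff using g that by blast
  have "L-lipschitz_on S g"
  proof (rule lipschitz_onI[OF _ L])
    fix x y assume "x \<in> S" "y \<in> S"
    then show "dist (g x) (g y) \<le> L * dist x y"
      by (intro LIMSEQ_le_const2[OF tendsto_dist[OF lim lim]] exI allI impI lipschitz_onD[OF lip])
  qed
  then show ?thesis using r lim by blast
qed

lemma inner_vector_derivative_ge:
  assumes \<gamma>: "(\<gamma> has_vector_derivative u) (at t)" and "0 < h"
    and slope: "\<And>d. \<lbrakk>0 < d; d < h\<rbrakk> \<Longrightarrow> b * d \<le> a \<bullet> (\<gamma> t - \<gamma> (t + d))"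
  shows "b \<le> a \<bullet> - u"
proof (rule ccontr)
  assume "\<not> ?thesis"
  then have "0 < a \<bullet> u + b" by simp
  moreover have "((\<lambda>s. a \<bullet> \<gamma> s) has_real_derivative a \<bullet> u) (at t)"
    using bounded_linear.has_vector_derivative[OF bounded_linear_inner_right \<gamma>, of a]
    by (simp add: has_real_derivative_iff_has_vector_derivative)
  then have "((\<lambda>s. a \<bullet> \<gamma> s + b * s) has_real_derivative a \<bullet> u + b) (at t)"
    by (auto intro!: derivative_eq_intros)
  ultimately obtain d where d: "0 < d"
    "\<And>s. \<lbrakk>0 < s; s < d\<rbrakk> \<Longrightarrow> a \<bullet> \<gamma> t + b * t < a \<bullet> \<gamma> (t + s) + b * (t + s)"
    using has_real_derivative_pos_inc_right[of "\<lambda>s. a \<bullet> \<gamma> s + b * s" "a \<bullet> u + b" t UNIV] by auto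
  define e where "e = min d h / 2"
  have "0 < e" "e < d" "e < h" using d(1) \<open>0 < h\<close> by (auto simp: e_def)
  then show False using d(2)[of e] slope[of e] by (simp add: inner_diff_right algebra_simps)
qed

locale euler_iteration =
  fixes z v :: "nat \<Rightarrow> 'a::euclidean_space" and \<eta> :: "nat \<Rightarrow> real" and G :: "'a \<Rightarrow> 'a set"
  assumes step: "\<And>k. z (Suc k) = z k - \<eta> k *\<^sub>R v k"
    and z_bounded: "bounded (range z)"
    and v_bounded: "bounded (range v)"
    and eta_nonneg: "\<And>k. 0 \<le> \<eta> k"
    and eta_lim: "\<eta> \<longlonglongrightarrow> 0"
    and eta_not_summable: "\<not> summable \<eta>"
    and G_convex: "\<And>p. convex (G p)"
    and G_closed: "\<And>p. closed (G p)"
    and G_limit: "\<And>r p u. \<lbrakk>strict_mono r; (\<lambda>j. z (r j)) \<longlonglongrightarrow> p; (\<lambda>j. v (r j)) \<longlonglongrightarrow> u\<rbrakk> \<Longrightarrow> u \<in> G p"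
begin

definition speed :: real where "speed = (SUP k. norm (v k))"

definition time :: "nat \<Rightarrow> real" where "time k = (\<Sum>i<k. \<eta> i)"

text \<open>\<open>pass i s\<close> is the time a clock running from \<open>0\<close> to \<open>s\<close> spends in step \<open>i\<close>.\<close>
definition pass :: "nat \<Rightarrow> real \<Rightarrow> real" where "pass i s = min s (time (Suc i)) - min s (time i)"

definition interpolation :: "real \<Rightarrow> 'a" where
  "interpolation s = z 0 - (\<Sum>i | time i < s. pass i s *\<^sub>R v i)"

lemma v_bound: "norm (v k) \<le> speed"
proof -
  have "bdd_above (range (\<lambda>k. norm (v k)))"
    using v_bounded by (auto simp: bounded_iff intro: bdd_aboveI)
  then show ?thesis unfolding speed_def by (intro cSUP_upper) auto
qed

lemma speed_nonneg: "0 \<le> speed"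
  using v_bound[of 0] norm_ge_zero order_trans by blast

lemma time_0 [simp]: "time 0 = 0" and time_Suc: "time (Suc k) = time k + \<eta> k"
  by (auto simp: time_def)

lemma time_mono: "i \<le> j \<Longrightarrow> time i \<le> time j"
  by (rule lift_Suc_mono_le[of time]) (auto simp: time_Suc eta_nonneg)

lemma time_nonneg: "0 \<le> time k"
  using time_mono[of 0 k] by simp

lemma less_of_time_less: "time i < time j \<Longrightarrow> i < j"
  using time_mono not_le by (meson leD)

lemma time_unbounded: "\<exists>N. C < time N"
proof (rule ccontr)
  assume "\<not> ?thesis"
  then have "\<And>n. (\<Sum>i<n. \<eta> i) \<le> C" by (auto simp: time_def not_less)
  then have "summable \<eta>" by (rule summableI_nonneg_bounded[OF eta_nonneg])
  then show False using eta_not_summable by simp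
qed

lemma time_at_top: "filterlim time at_top sequentially"
  unfolding filterlim_at_top_dense
proof
  fix C
  obtain N where "C < time N" using time_unbounded by blast
  then show "\<forall>\<^sub>F k in sequentially. C < time k"
    using time_mono by (auto simp: eventually_sequentially intro: less_le_trans)
qed

lemma exists_step_at:
  assumes "0 \<le> s"
  obtains i where "time i \<le> s" "s < time (Suc i)"
proof -
  obtain N where N: "s < time N" "\<And>i. i < N \<Longrightarrow> \<not> s < time i"
    using time_unbounded exists_least_iff[of "\<lambda>N. s < time N"] by blast
  then obtain i where "N = Suc i" using assms by (cases N) auto
  then show thesis using that[of i] N(1) N(2)[of i] by auto
qed

lemma pass_mono: "s \<le> s' \<Longrightarrow> pass i s \<le> pass i s'"
  using eta_nonneg[of i] by (auto simp: pass_def time_Suc min_def)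

lemma sum_pass: "0 \<le> s \<Longrightarrow> (\<Sum>i<N. pass i s) = min s (time N)"
  by (induction N) (auto simp: pass_def)

lemma interpolation_eq:
  assumes "s \<le> time N"
  shows "interpolation s = z 0 - (\<Sum>i<N. pass i s *\<^sub>R v i)"
proof -
  have "{i. time i < s} \<subseteq> {..<N}" using assms less_of_time_less by fastforce
  moreover have "pass i s = 0" if "s \<le> time i" for i
    using that eta_nonneg[of i] by (simp add: pass_def time_Suc)
  ultimately have "(\<Sum>i | time i < s. pass i s *\<^sub>R v i) = (\<Sum>i<N. pass i s *\<^sub>R v i)"
    by (intro sum.mono_neutral_left) auto
  then show ?thesis by (simp add: interpolation_def)
qed

lemma interpolation_diff:
  assumes "s \<le> time N" "s' \<le> time N"
  shows "interpolation s - interpolation s' = (\<Sum>i<N. (pass i s' - pass i s) *\<^sub>R v i)"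
  using assms by (simp add: interpolation_eq scaleR_diff_left sum_subtractf)

lemma interpolation_time: "interpolation (time k) = z k"
proof -
  have "z k = z 0 - (\<Sum>i<k. \<eta> i *\<^sub>R v i)" by (induction k) (auto simp: step)
  moreover have "pass i (time k) = \<eta> i" if "i < k" for i
    using time_mono[of "Suc i" k] time_mono[of i k] that by (auto simp: pass_def time_Suc min_def)
  then have "(\<Sum>i<k. pass i (time k) *\<^sub>R v i) = (\<Sum>i<k. \<eta> i *\<^sub>R v i)" by simp
  ultimately show ?thesis using interpolation_eq[of "time k" k] by simp
qed

lemma interpolation_lipschitz: "speed-lipschitz_on {0..} interpolation"
proof (rule lipschitz_onI[OF _ speed_nonneg])
  fix s s' :: real assume "s \<in> {0..}" "s' \<in> {0..}"
  then show "dist (interpolation s) (interpolation s') \<le> speed * dist s s'"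
  proof (induction s s' rule: linorder_wlog)
    case (le s s')
    obtain N where N: "s' < time N" using time_unbounded by blast
    have "dist (interpolation s) (interpolation s') \<le> (\<Sum>i<N. (pass i s' - pass i s) * speed)"
      using le N interpolation_diff[of s N s'] pass_mono[OF le(1)] v_bound
      by (auto simp: dist_norm intro!: sum_norm_le mult_left_mono)
    also have "\<dots> = (s' - s) * speed"
      using le N by (simp add: sum_distrib_right[symmetric] sum_subtractf sum_pass)
    finally show ?case using le(1) by (simp add: dist_real_def mult.commute)
  qed (simp add: dist_commute)
qed

lemma norm_interpolation_diff_le:
  "\<lbrakk>0 \<le> s; 0 \<le> s'\<rbrakk> \<Longrightarrow> norm (interpolation s - interpolation s') \<le> speed * \<bar>s - s'\<bar>"
  using lipschitz_on_normD[OF interpolation_lipschitz, of s s'] by simp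

lemma norm_iterate_interpolation_le:
  "0 \<le> s \<Longrightarrow> norm (z i - interpolation s) \<le> speed * \<bar>time i - s\<bar>"
  using norm_interpolation_diff_le[OF time_nonneg[of i], of s] by (simp add: interpolation_time)

lemma interpolation_bounded: "bounded (interpolation ` {0..})"
proof -
  obtain B where B: "\<And>k. norm (z k) \<le> B" using z_bounded by (auto simp: bounded_iff)
  obtain C where C: "\<And>k. \<bar>\<eta> k\<bar> \<le> C"
    using convergent_imp_bounded[OF eta_lim] by (auto simp: bounded_iff)
  have "norm (interpolation s) \<le> B + speed * C" if s: "0 \<le> s" for s
  proof -
    obtain i where i: "time i \<le> s" "s < time (Suc i)" using exists_step_at[OF s] .
    have "norm (z i - interpolation s) \<le> speed * \<bar>time i - s\<bar>"
      by (rule norm_iterate_interpolation_le[OF s])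
    also have "\<dots> \<le> speed * C"
      using i C[of i] speed_nonneg by (intro mult_left_mono) (auto simp: time_Suc)
    finally show ?thesis
      using B[of i] norm_triangle_sub[of "interpolation s" "z i"] by (simp add: norm_minus_commute)
  qed
  then show ?thesis by (auto simp: bounded_iff)
qed

lemma direction_in_halfspace_near:
  assumes half: "\<And>u. u \<in> G p \<Longrightarrow> b < a \<bullet> u"
  obtains e where "0 < e" "\<forall>\<^sub>F i in sequentially. norm (z i - p) < e \<longrightarrow> b < a \<bullet> v i"
proof (rule ccontr)
  assume "\<not> thesis"
  then have "\<not> (\<forall>\<^sub>F i in sequentially. norm (z i - p) < inverse (real (Suc n)) \<longrightarrow> b < a \<bullet> v i)" for n
    using that[of "inverse (real (Suc n))"] by auto
  then have "\<exists>\<^sub>F i in sequentially. norm (z i - p) < inverse (real (Suc n)) \<and> a \<bullet> v i \<le> b" for n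
    by (simp add: not_eventually not_less)
  then have "\<exists>i>j. norm (z i - p) < inverse (real (Suc n)) \<and> a \<bullet> v i \<le> b" for n j
    by (auto simp: frequently_sequentially Suc_le_eq[symmetric] simp del: of_nat_Suc)
  then have "\<exists>r. \<forall>n. (norm (z (r n) - p) < inverse (real (Suc n)) \<and> a \<bullet> v (r n) \<le> b) \<and> r n < r (Suc n)"
    by (intro dependent_nat_choice) metis+
  then obtain r where r: "strict_mono r" "\<And>n. norm (z (r n) - p) < inverse (real (Suc n))"
    "\<And>n. a \<bullet> v (r n) \<le> b"
    by (auto simp: strict_mono_Suc_iff)
  have "(\<lambda>n. z (r n) - p) \<longlonglongrightarrow> 0"
    by (rule Lim_null_comparison[OF _ LIMSEQ_inverse_real_of_nat])
      (use r(2) in \<open>auto intro!: always_eventually less_imp_le\<close>)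
  then have z_lim: "(\<lambda>n. z (r n)) \<longlonglongrightarrow> p" by (simp add: LIM_zero_iff)
  have "bounded (range (\<lambda>n. v (r n)))" by (rule bounded_subset[OF v_bounded]) auto
  then obtain u f where f: "strict_mono f" "((\<lambda>n. v (r n)) \<circ> f) \<longlonglongrightarrow> u"
    using bounded_imp_convergent_subsequence by blast
  have "u \<in> G p"
    using LIMSEQ_subseq_LIMSEQ[OF z_lim f(1)] f(2)
    by (intro G_limit[of "r \<circ> f"] strict_mono_o r(1) f(1)) (auto simp: o_def)
  moreover have "a \<bullet> u \<le> b"
    using r(3) by (intro LIMSEQ_le_const2[OF tendsto_inner[OF tendsto_const f(2)]]) auto
  ultimately show False using half by force
qed

lemma average_direction_in_halfspace:
  assumes near: "\<And>i. \<lbrakk>s - \<eta> i < time i; time i < s'\<rbrakk> \<Longrightarrow> b \<le> a \<bullet> v i" and s: "0 \<le> s" "s \<le> s'"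
  shows "b * (s' - s) \<le> a \<bullet> (interpolation s - interpolation s')"
proof -
  obtain N where N: "s' < time N" using time_unbounded by blast
  have "(pass i s' - pass i s) * b \<le> (pass i s' - pass i s) * (a \<bullet> v i)" for i
  proof (cases "s - \<eta> i < time i \<and> time i < s'")
    case True
    then show ?thesis using near pass_mono[OF s(2), of i] by (intro mult_left_mono) auto
  next
    case False
    then have "pass i s' = pass i s"
      using s eta_nonneg[of i] by (auto simp: pass_def time_Suc min_def)
    then show ?thesis by simp
  qed
  then have "(\<Sum>i<N. (pass i s' - pass i s) * b) \<le> (\<Sum>i<N. (pass i s' - pass i s) * (a \<bullet> v i))"
    by (intro sum_mono)
  also have "\<dots> = a \<bullet> (interpolation s - interpolation s')"
    using N s by (subst interpolation_diff[of _ N]) (auto simp: inner_sum_right)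
  finally show ?thesis
    using s N unfolding sum_distrib_right[symmetric] by (simp add: sum_subtractf sum_pass mult.commute)
qed

lemma eventually_average_direction_in_halfspace:
  assumes t: "filterlim t at_top sequentially" and lim: "(\<lambda>j. interpolation (t j)) \<longlonglongrightarrow> p"
    and half: "\<And>u. u \<in> G p \<Longrightarrow> b < a \<bullet> u"
  obtains h where "0 < h"
    "\<forall>d\<in>{0<..<h}. \<forall>\<^sub>F j in sequentially. b * d \<le> a \<bullet> (interpolation (t j) - interpolation (t j + d))"
proof -
  obtain e where e: "0 < e" "\<forall>\<^sub>F i in sequentially. norm (z i - p) < e \<longrightarrow> b < a \<bullet> v i"
    using direction_in_halfspace_near[OF half] by blast
  define h where "h = e / (2 * (speed + 1))"
  have h: "0 < h" "speed * h \<le> e / 2" using e(1) speed_nonneg by (auto simp: h_def field_simps)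
  have "\<forall>\<^sub>F i in sequentially. \<eta> i < h" using order_tendstoD(2)[OF eta_lim h(1)] .
  with e(2) obtain K where K: "\<And>i. \<lbrakk>K \<le> i; norm (z i - p) < e\<rbrakk> \<Longrightarrow> b < a \<bullet> v i" "\<And>i. K \<le> i \<Longrightarrow> \<eta> i < h"
    unfolding eventually_sequentially by (metis le_trans linorder_linear)
  have "\<forall>\<^sub>F j in sequentially. b * d \<le> a \<bullet> (interpolation (t j) - interpolation (t j + d))"
    if d: "d \<in> {0<..<h}" for d
  proof -
    have "\<forall>\<^sub>F j in sequentially. time K < t j" using t by (simp add: filterlim_at_top_dense)
    moreover have "\<forall>\<^sub>F j in sequentially. norm (interpolation (t j) - p) < e / 2"
      using tendstoD[OF lim, of "e / 2"] e(1) by (simp add: dist_norm)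
    ultimately show ?thesis
    proof eventually_elim
      case (elim j)
      have tj: "0 \<le> t j" using elim(1) time_nonneg[of K] by linarith
      have "b * (t j + d - t j) \<le> a \<bullet> (interpolation (t j) - interpolation (t j + d))"
      proof (rule average_direction_in_halfspace)
        fix i assume i: "t j - \<eta> i < time i" "time i < t j + d"
        have "time K < time (Suc i)" using i(1) elim(1) by (simp add: time_Suc)
        then have Ki: "K \<le> i" using less_of_time_less by fastforce
        have "\<bar>time i - t j\<bar> \<le> h" using i d K(2)[OF Ki] by auto
        then have "speed * \<bar>time i - t j\<bar> \<le> e / 2"
          using h(2) speed_nonneg by (meson mult_left_mono order_trans)
        then have "norm (z i - interpolation (t j)) \<le> e / 2"
          using norm_iterate_interpolation_le[OF tj] order_trans by blast
        then have "norm (z i - p) < e"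
          using elim(2) norm_triangle_ineq[of "z i - interpolation (t j)" "interpolation (t j) - p"] by simp
        then show "b \<le> a \<bullet> v i" using K(1)[OF Ki] by simp
      qed (use tj d in auto)
      then show ?case by simp
    qed
  qed
  then show thesis using that h(1) by blast
qed

lemma limit_curve_solves_inclusion:
  assumes t: "filterlim t at_top sequentially"
    and lim: "\<And>s. s \<in> {0..T} \<Longrightarrow> (\<lambda>j. interpolation (t j + s)) \<longlonglongrightarrow> \<gamma> s"
    and s: "s \<in> {0<..<T}" and u: "(\<gamma> has_vector_derivative u) (at s)"
  shows "- u \<in> G (\<gamma> s)"
proof (rule ccontr)
  assume "- u \<notin> G (\<gamma> s)"
  then obtain a b where ab: "a \<bullet> - u < b" "\<And>w. w \<in> G (\<gamma> s) \<Longrightarrow> b < a \<bullet> w"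
    using separating_hyperplane_closed_point[OF G_convex G_closed] by blast
  have sT: "s \<in> {0..T}" using s by simp
  have "filterlim (\<lambda>j. t j + s) at_top sequentially"
    by (rule filterlim_at_top_mono[OF t]) (use s in auto)
  from eventually_average_direction_in_halfspace[OF this lim[OF sT] ab(2)]
  obtain h where h: "0 < h" "\<forall>d\<in>{0<..<h}.
    \<forall>\<^sub>F j in sequentially. b * d \<le> a \<bullet> (interpolation (t j + s) - interpolation (t j + s + d))" by blast
  have "b \<le> a \<bullet> - u"
  proof (rule inner_vector_derivative_ge[OF u])
    show "0 < min h (T - s)" using h(1) s by simp
    fix d assume d: "0 < d" "d < min h (T - s)"
    have "(\<lambda>j. a \<bullet> (interpolation (t j + s) - interpolation (t j + s + d))) \<longlonglongrightarrow> a \<bullet> (\<gamma> s - \<gamma> (s + d))"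
      using lim[of "s + d"] s d by (intro tendsto_intros lim[OF sT]) (simp add: add.assoc)
    then show "b * d \<le> a \<bullet> (\<gamma> s - \<gamma> (s + d))"
      by (rule tendsto_lowerbound) (use h(2) d in auto)
  qed
  then show False using ab(1) by simp
qed

sublocale asymptotic_trajectory interpolation G
proof
  show "\<exists>L. L-lipschitz_on {0..} interpolation" using interpolation_lipschitz by blast
  show "bounded (interpolation ` {0..})" by (rule interpolation_bounded)
next
  fix t :: "nat \<Rightarrow> real" and T :: real
  assume t: "filterlim t at_top sequentially" and T: "0 < T"
  obtain B where B: "\<And>s. 0 \<le> s \<Longrightarrow> norm (interpolation s) \<le> B"
    using interpolation_bounded by (auto simp: bounded_iff)
  obtain N where N: "\<And>j. N \<le> j \<Longrightarrow> 0 \<le> t j"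
    using t by (auto simp: filterlim_at_top eventually_sequentially)
  define X where "X j s = interpolation (t (j + N) + s)" for j s
  have "speed-lipschitz_on {0..T} (X j)" for j
  proof (rule lipschitz_onI[OF _ speed_nonneg])
    fix s s' assume "s \<in> {0..T}" "s' \<in> {0..T}"
    then show "dist (X j s) (X j s') \<le> speed * dist s s'"
      using norm_interpolation_diff_le[of "t (j + N) + s" "t (j + N) + s'"] N[of "j + N"]
      by (simp add: X_def dist_norm)
  qed
  moreover have "norm (X j s) \<le> B" if "s \<in> {0..T}" for j s
    unfolding X_def using N[of "j + N"] that by (intro B) auto
  ultimately have "\<exists>\<gamma> r. strict_mono (r :: nat \<Rightarrow> nat) \<and> speed-lipschitz_on {0..T} \<gamma>
      \<and> (\<forall>s\<in>{0..T}. (\<lambda>j. X (r j) s) \<longlonglongrightarrow> \<gamma> s)"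
    by (intro uniformly_lipschitz_subsequence[OF compact_Icc])
  then obtain \<gamma> r where r: "strict_mono (r :: nat \<Rightarrow> nat)" and \<gamma>: "speed-lipschitz_on {0..T} \<gamma>"
    and lim: "\<And>s. s \<in> {0..T} \<Longrightarrow> (\<lambda>j. interpolation (t (r j + N) + s)) \<longlonglongrightarrow> \<gamma> s"
    unfolding X_def by blast
  have r': "strict_mono (\<lambda>j. r j + N)" using r by (simp add: strict_mono_def)
  have "filterlim (\<lambda>j. t (r j + N)) at_top sequentially"
    by (rule filterlim_compose[OF t filterlim_subseq[OF r']])
  then have "\<forall>s\<in>{0<..<T}. \<forall>u. (\<gamma> has_vector_derivative u) (at s) \<longrightarrow> - u \<in> G (\<gamma> s)"
    by (intro ballI allI impI limit_curve_solves_inclusion[of "\<lambda>j. t (r j + N)" T \<gamma>] lim)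
  then have "descent_trajectory G T \<gamma>" using \<gamma> unfolding descent_trajectory_def by blast
  then show "\<exists>\<gamma> r. strict_mono (r :: nat \<Rightarrow> nat) \<and> descent_trajectory G T \<gamma> \<and>
      (\<forall>s\<in>{0..T}. (\<lambda>j. interpolation (t (r j) + s)) \<longlonglongrightarrow> \<gamma> s)"
    using r' lim by (intro exI[of _ \<gamma>] exI[of _ "\<lambda>j. r j + N"]) simp
qed

end

section \<open>Derivatives and matrices\<close>

lemma has_vector_derivative_imp_quotient_tendsto:
  assumes "(\<gamma> has_vector_derivative u) (at t)"
  shows "((\<lambda>s. (\<gamma> s - \<gamma> t) /\<^sub>R (s - t)) \<longlongrightarrow> u) (at t)"
proof -
  have "((\<lambda>s. norm (\<gamma> s - \<gamma> t - (s - t) *\<^sub>R u) / norm (s - t)) \<longlongrightarrow> 0) (at t)"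
    using assms by (simp add: has_vector_derivative_def has_derivative_iff_norm)
  moreover have "\<forall>\<^sub>F s in at t. norm (\<gamma> s - \<gamma> t - (s - t) *\<^sub>R u) / norm (s - t)
      = norm ((\<gamma> s - \<gamma> t) /\<^sub>R (s - t) - u)"
  proof (rule eventually_at_filter[THEN iffD2, OF always_eventually], intro allI impI)
    fix s assume "s \<noteq> t"
    then have "\<gamma> s - \<gamma> t - (s - t) *\<^sub>R u = (s - t) *\<^sub>R ((\<gamma> s - \<gamma> t) /\<^sub>R (s - t) - u)"
      by (simp add: scaleR_diff_right)
    then show "norm (\<gamma> s - \<gamma> t - (s - t) *\<^sub>R u) / norm (s - t) = norm ((\<gamma> s - \<gamma> t) /\<^sub>R (s - t) - u)"
      using \<open>s \<noteq> t\<close> by simp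
  qed
  ultimately have "((\<lambda>s. norm ((\<gamma> s - \<gamma> t) /\<^sub>R (s - t) - u)) \<longlongrightarrow> 0) (at t)"
    by (rule Lim_transform_eventually)
  then show ?thesis using LIM_zero_iff tendsto_norm_zero_iff by blast
qed

lemma norm_vector_derivative_le:
  assumes F: "(F has_vector_derivative D) (at t)" and \<sigma>: "(\<sigma> has_vector_derivative u) (at t)"
    and le: "\<And>s. norm (F s - F t) \<le> C s * norm (\<sigma> s - \<sigma> t)" and C: "(C \<longlongrightarrow> c) (at t)"
  shows "norm D \<le> c * norm u"
proof (rule tendsto_le[OF trivial_limit_at])
  show "((\<lambda>s. norm ((F s - F t) /\<^sub>R (s - t))) \<longlongrightarrow> norm D) (at t)"
    by (intro tendsto_norm has_vector_derivative_imp_quotient_tendsto F)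
  show "((\<lambda>s. C s * norm ((\<sigma> s - \<sigma> t) /\<^sub>R (s - t))) \<longlongrightarrow> c * norm u) (at t)"
    by (intro tendsto_mult C tendsto_norm has_vector_derivative_imp_quotient_tendsto \<sigma>)
  have "norm ((F s - F t) /\<^sub>R (s - t)) \<le> C s * norm ((\<sigma> s - \<sigma> t) /\<^sub>R (s - t))" for s
    using mult_left_mono[OF le[of s], of "\<bar>inverse (s - t)\<bar>"] by (simp add: ac_simps)
  then show "\<forall>\<^sub>F s in at t. norm ((F s - F t) /\<^sub>R (s - t)) \<le> C s * norm ((\<sigma> s - \<sigma> t) /\<^sub>R (s - t))"
    by simp
qed

lemma has_vector_derivative_along_curve:
  assumes "(\<sigma> has_vector_derivative u) (at t)" "(F has_derivative F') (at (\<sigma> t))"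
  shows "((\<lambda>s. F (\<sigma> s)) has_vector_derivative F' u) (at t)"
  using vector_derivative_diff_chain_within[OF assms(1) has_derivative_at_withinI[OF assms(2)]]
  by (simp add: o_def)

lemma has_vector_derivative_line: "((\<lambda>t. p + t *\<^sub>R a) has_vector_derivative a) (at t)"
  by (auto intro!: derivative_eq_intros)

lemma norm_derivative_le_lipschitz:
  fixes F :: "'a::real_normed_vector \<Rightarrow> 'b::real_normed_vector"
  assumes der: "(F has_derivative D) (at z)" and lip: "L-lipschitz_on UNIV F"
  shows "norm (D w) \<le> L * norm w"
proof (rule norm_vector_derivative_le)
  show "((\<lambda>t. z + t *\<^sub>R w) has_vector_derivative w) (at 0)" by (rule has_vector_derivative_line)
  show "((\<lambda>t. F (z + t *\<^sub>R w)) has_vector_derivative D w) (at 0)"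
    by (rule has_vector_derivative_along_curve[OF has_vector_derivative_line]) (simp add: der)
  show "norm (F (z + s *\<^sub>R w) - F (z + 0 *\<^sub>R w)) \<le> L * norm (z + s *\<^sub>R w - (z + 0 *\<^sub>R w))" for s
    by (rule lipschitz_on_normD[OF lip]) auto
qed (rule tendsto_const)

definition second_difference :: "('a::ab_group_add \<Rightarrow> real) \<Rightarrow> 'a \<Rightarrow> 'a \<Rightarrow> 'a \<Rightarrow> real" where
  "second_difference \<phi> y a b = \<phi> (y + a + b) - \<phi> (y + a) - \<phi> (y + b) + \<phi> y"

lemma second_difference_commute: "second_difference \<phi> y a b = second_difference \<phi> y b a"
  by (simp add: second_difference_def ac_simps)

lemma second_difference_mean_value:
  fixes \<phi> :: "'a::real_inner \<Rightarrow> real"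
  assumes grad: "\<And>y. (\<phi> has_derivative (\<lambda>v. G y \<bullet> v)) (at y)"
    and hess: "\<And>y. (G has_derivative H y) (at y)" and s: "0 < s"
  shows "\<exists>\<xi>\<in>{0<..<s}. \<exists>\<zeta>\<in>{0<..<s}.
    second_difference \<phi> y (s *\<^sub>R a) (s *\<^sub>R b)
      = s\<^sup>2 * (H (y + \<xi> *\<^sub>R a + \<zeta> *\<^sub>R b) b \<bullet> a)"
proof -
  have d\<phi>: "((\<lambda>t. \<phi> (p + t *\<^sub>R a)) has_real_derivative G (p + t *\<^sub>R a) \<bullet> a) (at t)" for p t
    unfolding has_real_derivative_iff_has_vector_derivative
    by (rule has_vector_derivative_along_curve[OF has_vector_derivative_line grad])
  have dG: "((\<lambda>t. G (p + t *\<^sub>R b) \<bullet> a) has_real_derivative H (p + t *\<^sub>R b) b \<bullet> a) (at t)" for p t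
    unfolding has_real_derivative_iff_has_vector_derivative
    by (rule bounded_linear.has_vector_derivative[OF bounded_linear_inner_left
          has_vector_derivative_along_curve[OF has_vector_derivative_line hess]])
  have "((\<lambda>t. \<phi> (y + s *\<^sub>R b + t *\<^sub>R a) - \<phi> (y + t *\<^sub>R a)) has_real_derivative
      G (y + s *\<^sub>R b + t *\<^sub>R a) \<bullet> a - G (y + t *\<^sub>R a) \<bullet> a) (at t)" for t
    by (intro DERIV_diff d\<phi>)
  from MVT2[OF s this] obtain \<xi> where \<xi>: "0 < \<xi>" "\<xi> < s"
    "\<phi> (y + s *\<^sub>R b + s *\<^sub>R a) - \<phi> (y + s *\<^sub>R a) - (\<phi> (y + s *\<^sub>R b) - \<phi> y)
      = s * (G (y + s *\<^sub>R b + \<xi> *\<^sub>R a) \<bullet> a - G (y + \<xi> *\<^sub>R a) \<bullet> a)" by auto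
  from MVT2[OF s dG[of "y + \<xi> *\<^sub>R a"]] obtain \<zeta> where \<zeta>: "0 < \<zeta>" "\<zeta> < s"
    "G (y + \<xi> *\<^sub>R a + s *\<^sub>R b) \<bullet> a - G (y + \<xi> *\<^sub>R a) \<bullet> a = s * (H (y + \<xi> *\<^sub>R a + \<zeta> *\<^sub>R b) b \<bullet> a)" by auto
  have "second_difference \<phi> y (s *\<^sub>R a) (s *\<^sub>R b)
      = s * (G (y + \<xi> *\<^sub>R a + s *\<^sub>R b) \<bullet> a - G (y + \<xi> *\<^sub>R a) \<bullet> a)"
    using \<xi>(3) by (simp add: second_difference_def ac_simps)
  also have "\<dots> = s\<^sup>2 * (H (y + \<xi> *\<^sub>R a + \<zeta> *\<^sub>R b) b \<bullet> a)" by (simp add: \<zeta>(3) power2_eq_square)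
  finally show ?thesis using \<xi>(1,2) \<zeta>(1,2) by (intro bexI[of _ \<xi>] bexI[of _ \<zeta>]) simp_all
qed

lemma second_difference_quotient_tendsto:
  fixes \<phi> :: "'a::real_inner \<Rightarrow> real"
  assumes grad: "\<And>y. (\<phi> has_derivative (\<lambda>v. G y \<bullet> v)) (at y)"
    and hess: "\<And>y. (G has_derivative H y) (at y)"
    and cont: "isCont (\<lambda>y. H y b) y"
  shows "((\<lambda>s. second_difference \<phi> y (s *\<^sub>R a) (s *\<^sub>R b) / s\<^sup>2)
    \<longlongrightarrow> H y b \<bullet> a) (at_right 0)"
proof -
  have "\<forall>s. \<exists>\<xi> \<zeta>. 0 < s \<longrightarrow> \<xi> \<in> {0<..<s} \<and> \<zeta> \<in> {0<..<s} \<and>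
      second_difference \<phi> y (s *\<^sub>R a) (s *\<^sub>R b)
        = s\<^sup>2 * (H (y + \<xi> *\<^sub>R a + \<zeta> *\<^sub>R b) b \<bullet> a)"
    using second_difference_mean_value[OF grad hess, of _ y a b] by blast
  then obtain \<xi> \<zeta> where \<xi>: "\<And>s. 0 < s \<Longrightarrow> \<xi> s \<in> {0<..<s}" and \<zeta>: "\<And>s. 0 < s \<Longrightarrow> \<zeta> s \<in> {0<..<s}"
    and eq: "\<And>s. 0 < s \<Longrightarrow> second_difference \<phi> y (s *\<^sub>R a) (s *\<^sub>R b)
        = s\<^sup>2 * (H (y + \<xi> s *\<^sub>R a + \<zeta> s *\<^sub>R b) b \<bullet> a)"
    by metis
  have squeeze: "(\<rho> \<longlongrightarrow> 0) (at_right 0)" if "\<And>s. 0 < s \<Longrightarrow> \<rho> s \<in> {0<..<s}" for \<rho> :: "real \<Rightarrow> real"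
  proof (rule tendsto_sandwich[OF _ _ tendsto_const tendsto_ident_at])
    show "\<forall>\<^sub>F s in at_right 0. 0 \<le> \<rho> s" "\<forall>\<^sub>F s in at_right 0. \<rho> s \<le> s"
      using that by (auto simp: eventually_at_filter intro!: always_eventually less_imp_le)
  qed
  have "((\<lambda>s. y + \<xi> s *\<^sub>R a + \<zeta> s *\<^sub>R b) \<longlongrightarrow> y + 0 *\<^sub>R a + 0 *\<^sub>R b) (at_right 0)"
    by (intro tendsto_intros squeeze \<xi> \<zeta>)
  then have "((\<lambda>s. H (y + \<xi> s *\<^sub>R a + \<zeta> s *\<^sub>R b) b \<bullet> a) \<longlongrightarrow> H y b \<bullet> a) (at_right 0)"
    by (intro tendsto_inner tendsto_const isCont_tendsto_compose[OF cont]) simp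
  moreover have "\<forall>\<^sub>F s in at_right 0. H (y + \<xi> s *\<^sub>R a + \<zeta> s *\<^sub>R b) b \<bullet> a
      = second_difference \<phi> y (s *\<^sub>R a) (s *\<^sub>R b) / s\<^sup>2"
    using eq by (auto simp: eventually_at_filter intro!: always_eventually)
  ultimately show ?thesis by (rule Lim_transform_eventually)
qed

theorem second_derivative_symmetric:
  fixes \<phi> :: "'a::real_inner \<Rightarrow> real"
  assumes grad: "\<And>y. (\<phi> has_derivative (\<lambda>v. G y \<bullet> v)) (at y)"
    and hess: "\<And>y. (G has_derivative H y) (at y)"
    and cont: "\<And>v. isCont (\<lambda>y. H y v) y"
  shows "H y b \<bullet> a = H y a \<bullet> b"
proof (rule tendsto_unique[OF trivial_limit_at_right_real])
  show "((\<lambda>s. second_difference \<phi> y (s *\<^sub>R a) (s *\<^sub>R b) / s\<^sup>2)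
      \<longlongrightarrow> H y b \<bullet> a) (at_right 0)"
    by (rule second_difference_quotient_tendsto[OF grad hess cont])
  show "((\<lambda>s. second_difference \<phi> y (s *\<^sub>R a) (s *\<^sub>R b) / s\<^sup>2)
      \<longlongrightarrow> H y a \<bullet> b) (at_right 0)"
    using second_difference_quotient_tendsto[OF grad hess cont, of b a]
    by (simp add: second_difference_commute)
qed

lemma norm_mult_le_opnorm: "norm (M *v w) \<le> opnorm M * norm w"
  unfolding opnorm_def by (rule onorm[OF matrix_vector_mul_bounded_linear])

lemma norm_vector_matrix_mult_le:
  fixes M :: "real^'m^'k"
  assumes M: "\<And>w. norm (M *v w) \<le> C * norm w" and "0 \<le> C"
  shows "norm (u v* M) \<le> C * norm u"
proof -
  have "(norm (u v* M))\<^sup>2 = u \<bullet> (M *v (u v* M))"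
    unfolding power2_norm_eq_inner by (rule dot_lmul_matrix)
  also have "\<dots> \<le> norm u * (C * norm (u v* M))"
    using norm_cauchy_schwarz M by (meson mult_left_mono norm_ge_zero order_trans)
  finally have "norm (u v* M) * norm (u v* M) \<le> (C * norm u) * norm (u v* M)"
    by (simp add: power2_eq_square ac_simps)
  then show ?thesis
    using \<open>0 \<le> C\<close> by (cases "u v* M = 0") (auto simp: mult_le_cancel_right)
qed

lemma isCont_if_opnorm_lipschitz:
  fixes M :: "'a::metric_space \<Rightarrow> real^'m^'k"
  assumes "\<And>z z'. opnorm (M z - M z') \<le> Q * dist z z'"
  shows "isCont M z"
  unfolding isCont_def
proof (intro vec_tendstoI)
  fix i j
  have "\<bar>M z' $ i $ j - M z $ i $ j\<bar> \<le> Q * dist z' z" for z'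
    using matrix_component_le_onorm[of "M z' - M z" i j] assms[of z' z] by (simp add: opnorm_def)
  moreover have "((\<lambda>z'. dist z' z) \<longlongrightarrow> dist z z) (at z)" by (intro tendsto_intros)
  then have "((\<lambda>z'. Q * dist z' z) \<longlongrightarrow> 0) (at z)" by (intro tendsto_mult_right_zero) simp
  ultimately have "((\<lambda>z'. M z' $ i $ j - M z $ i $ j) \<longlongrightarrow> 0) (at z)"
    by (intro Lim_null_comparison[of "\<lambda>z'. M z' $ i $ j - M z $ i $ j" "\<lambda>z'. Q * dist z' z"]) simp_all
  then show "((\<lambda>z'. M z' $ i $ j) \<longlongrightarrow> M z $ i $ j) (at z)" by (simp add: LIM_zero_iff)
qed

lemma tendsto_matrix_vector_mult:
  fixes M :: "'b \<Rightarrow> real^'m^'k"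
  assumes "(M \<longlongrightarrow> M0) F" "(w \<longlongrightarrow> w0) F"
  shows "((\<lambda>j. M j *v w j) \<longlongrightarrow> M0 *v w0) F"
  unfolding matrix_vector_mult_def by (intro tendsto_intros assms)

lemma tendsto_vector_matrix_mult:
  fixes M :: "'b \<Rightarrow> real^'m^'k"
  assumes "(u \<longlongrightarrow> u0) F" "(M \<longlongrightarrow> M0) F"
  shows "((\<lambda>j. u j v* M j) \<longlongrightarrow> u0 v* M0) F"
  unfolding vector_matrix_mult_def by (intro tendsto_intros assms)

lemma norm_mult_ge_if_coercive:
  fixes A :: "real^'m^'m"
  assumes "\<And>v. \<mu> * (norm v)\<^sup>2 \<le> v \<bullet> (A *v v)"
  shows "\<mu> * norm v \<le> norm (A *v v)"
proof (cases "v = 0")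
  case False
  have "\<mu> * norm v * norm v \<le> norm (A *v v) * norm v"
    using assms[of v] norm_cauchy_schwarz[of v "A *v v"] by (simp add: power2_eq_square ac_simps)
  then show ?thesis using False by (simp add: mult_le_cancel_right)
qed simp

lemma invertible_if_coercive:
  fixes A :: "real^'m^'m"
  assumes coercive: "\<And>v. \<mu> * (norm v)\<^sup>2 \<le> v \<bullet> (A *v v)" and "0 < \<mu>"
  shows "invertible A"
proof -
  have "inj ((*v) A)"
  proof (rule injI)
    fix v w assume "A *v v = A *v w"
    then have "\<mu> * norm (v - w) \<le> 0"
      using norm_mult_ge_if_coercive[OF coercive, of "v - w"]
      by (simp add: matrix_vector_mult_diff_distrib)
    then show "v = w" using \<open>0 < \<mu>\<close> by (simp add: mult_le_0_iff)
  qed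
  then show ?thesis
    by (simp add: invertible_left_inverse matrix_left_invertible_injective)
qed

lemma matrix_inv_vector_mult:
  fixes A :: "'a::semiring_1^'m^'k"
  assumes "invertible A"
  shows "A *v (matrix_inv A *v w) = w" "matrix_inv A *v (A *v v) = v"
proof -
  have "A ** matrix_inv A = mat 1 \<and> matrix_inv A ** A = mat 1"
    using assms unfolding invertible_def matrix_inv_def by (rule someI_ex)
  then show "A *v (matrix_inv A *v w) = w" "matrix_inv A *v (A *v v) = v"
    by (simp_all add: matrix_vector_mul_assoc)
qed

section \<open>The lower-level problem\<close>

type_synonym ('n, 'p) point = "(real^'n) \<times> (real^'p)"

locale lower_level =
  fixes g :: "('n::finite, 'p::finite) point \<Rightarrow> real"
    and gx :: "('n, 'p) point \<Rightarrow> real^'n"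
    and gy :: "('n, 'p) point \<Rightarrow> real^'p"
    and Hxy :: "('n, 'p) point \<Rightarrow> real^'p^'n"
    and Hyy :: "('n, 'p) point \<Rightarrow> real^'p^'p"
    and \<mu> Lg Qg :: real
  assumes \<mu>_pos: "0 < \<mu>" and Lg_pos: "0 < Lg" and Qg_pos: "0 < Qg"
    and g_grad: "\<And>z. (g has_derivative (\<lambda>(u, v). gx z \<bullet> u + gy z \<bullet> v)) (at z)"
    and gy_deriv: "\<And>z. (gy has_derivative (\<lambda>(u, v). u v* Hxy z + Hyy z *v v)) (at z)"
    and Hyy_pd: "\<And>z v. v \<bullet> (Hyy z *v v) \<ge> \<mu> * (norm v)\<^sup>2"
    and grad_lip: "Lg-lipschitz_on UNIV (\<lambda>z. (gx z, gy z))"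
    and Hyy_lip: "\<And>z z'. opnorm (Hyy z - Hyy z') \<le> Qg * dist z z'"
    and Hxy_lip: "\<And>z z'. opnorm (Hxy z - Hxy z') \<le> Qg * dist z z'"
begin

definition dgy :: "('n, 'p) point \<Rightarrow> ('n, 'p) point \<Rightarrow> real^'p"
  where "dgy z u = fst u v* Hxy z + Hyy z *v snd u"

definition Hinv :: "('n, 'p) point \<Rightarrow> real^'p \<Rightarrow> real^'p"
  where "Hinv z w = matrix_inv (Hyy z) *v w"

lemma isCont_Hyy: "isCont Hyy z" and isCont_Hxy: "isCont Hxy z"
  by (rule isCont_if_opnorm_lipschitz, rule Hyy_lip, rule isCont_if_opnorm_lipschitz, rule Hxy_lip)

lemma Hyy_symmetric: "(Hyy z *v b) \<bullet> a = (Hyy z *v a) \<bullet> b"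
proof -
  have slice: "(Pair (fst z) has_derivative (\<lambda>v. (0, v))) (at y)" for y :: "real^'p"
    by (auto intro!: derivative_eq_intros)
  have "((\<lambda>y. g (fst z, y)) has_derivative (\<lambda>v. gy (fst z, y) \<bullet> v)) (at y)" for y
    using has_derivative_compose[OF slice g_grad] by simp
  moreover have "((\<lambda>y. gy (fst z, y)) has_derivative (\<lambda>v. Hyy (fst z, y) *v v)) (at y)" for y
    using has_derivative_compose[OF slice gy_deriv] by simp
  moreover have "isCont (\<lambda>y. Hyy (fst z, y) *v v) (snd z)" for v
    unfolding isCont_def
    by (intro tendsto_matrix_vector_mult isCont_tendsto_compose[OF isCont_Hyy] tendsto_intros)
  ultimately have "(Hyy (fst z, snd z) *v b) \<bullet> a = (Hyy (fst z, snd z) *v a) \<bullet> b"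
    by (rule second_derivative_symmetric)
  then show ?thesis by simp
qed

lemma Hyy_Hinv [simp]: "Hyy z *v Hinv z w = w" and Hinv_Hyy [simp]: "Hinv z (Hyy z *v w) = w"
  using matrix_inv_vector_mult[OF invertible_if_coercive[OF Hyy_pd \<mu>_pos]] by (simp_all add: Hinv_def)

lemma linear_Hinv: "linear (Hinv z)"
  unfolding Hinv_def by (rule matrix_vector_mul_linear)

lemmas Hinv_linear_simps = linear_0[OF linear_Hinv] linear_add[OF linear_Hinv]
  linear_diff[OF linear_Hinv] linear_scale[OF linear_Hinv]

lemma norm_le_Hyy: "norm v \<le> norm (Hyy z *v v) / \<mu>"
  using norm_mult_ge_if_coercive[OF Hyy_pd, of v z] \<mu>_pos by (simp add: pos_le_divide_eq mult.commute)

lemma norm_Hinv: "norm (Hinv z w) \<le> norm w / \<mu>"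
  using norm_le_Hyy[of "Hinv z w" z] by simp

lemma Hinv_symmetric: "Hinv z a \<bullet> b = a \<bullet> Hinv z b"
  using Hyy_symmetric[of z "Hinv z b" "Hinv z a"] by (simp add: inner_commute)

lemma gy_lipschitz: "Lg-lipschitz_on UNIV gy"
proof (rule lipschitz_onI)
  show "dist (gy z) (gy z') \<le> Lg * dist z z'" for z z'
    using lipschitz_onD[OF grad_lip, of z z'] dist_snd_le[of "(gx z, gy z)" "(gx z', gy z')"] by simp
qed (use Lg_pos in simp)

lemma norm_gy_diff_le: "norm (gy z' - gy z) \<le> Lg * norm (z' - z)"
  by (rule lipschitz_on_normD[OF gy_lipschitz]) auto

lemma norm_dgy: "norm (dgy z u) \<le> Lg * norm u"
  using norm_derivative_le_lipschitz[OF gy_deriv gy_lipschitz, of z u]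
  by (simp add: dgy_def case_prod_beta)

lemma gy_along_curve:
  assumes "(\<sigma> has_vector_derivative u) (at t)"
  shows "((\<lambda>s. gy (\<sigma> s)) has_vector_derivative dgy (\<sigma> t) u) (at t)"
  using has_vector_derivative_along_curve[OF assms gy_deriv] by (simp add: dgy_def case_prod_beta)

lemma norm_vector_Hxy: "norm (u v* Hxy z) \<le> Lg * norm u"
  using norm_dgy[of z "(u, 0)"] by (simp add: dgy_def)

lemma norm_Hxy: "norm (Hxy z *v w) \<le> Lg * norm w"
  using norm_vector_matrix_mult_le[of "transpose (Hxy z)" Lg w] norm_vector_Hxy Lg_pos by simp

lemma \<mu>_le_Lg: "\<mu> \<le> Lg"
proof -
  obtain v :: "real^'p" where v: "norm v = 1" using vector_choose_size[of 1] by auto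
  then show ?thesis
    using norm_mult_ge_if_coercive[OF Hyy_pd, of v undefined] norm_dgy[of undefined "(0, v)"]
    by (simp add: dgy_def)
qed

lemma norm_Hyy_diff_mult: "norm ((Hyy z' - Hyy z) *v w) \<le> Qg * norm (z' - z) * norm w"
  using norm_mult_le_opnorm[of "Hyy z' - Hyy z" w] mult_right_mono[OF Hyy_lip, of "norm w" z' z]
  by (simp add: dist_norm)

lemma gy_tendsto: "(z \<longlongrightarrow> z0) F \<Longrightarrow> ((\<lambda>j. gy (z j)) \<longlongrightarrow> gy z0) F"
  by (rule isCont_tendsto_compose[OF has_derivative_continuous[OF gy_deriv]])

lemma Hyy_tendsto: "(z \<longlongrightarrow> z0) F \<Longrightarrow> ((\<lambda>j. Hyy (z j)) \<longlongrightarrow> Hyy z0) F"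
  by (rule isCont_tendsto_compose[OF isCont_Hyy])

lemma Hxy_tendsto: "(z \<longlongrightarrow> z0) F \<Longrightarrow> ((\<lambda>j. Hxy (z j)) \<longlongrightarrow> Hxy z0) F"
  by (rule isCont_tendsto_compose[OF isCont_Hxy])

lemma Hinv_tendsto:
  assumes z: "(z \<longlongrightarrow> z0) F" and w: "(w \<longlongrightarrow> w0) F"
  shows "((\<lambda>j. Hinv (z j) (w j)) \<longlongrightarrow> Hinv z0 w0) F"
proof -
  have "((\<lambda>j. norm (w j - Hyy (z j) *v Hinv z0 w0) / \<mu>) \<longlongrightarrow> norm (w0 - Hyy z0 *v Hinv z0 w0) / \<mu>) F"
    using \<mu>_pos
    by (intro tendsto_divide tendsto_norm tendsto_diff tendsto_const w
        tendsto_matrix_vector_mult Hyy_tendsto z) simp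
  moreover have "norm (Hinv (z j) (w j) - Hinv z0 w0) \<le> norm (w j - Hyy (z j) *v Hinv z0 w0) / \<mu>" for j
    using norm_le_Hyy[of "Hinv (z j) (w j) - Hinv z0 w0" "z j"]
    by (simp add: matrix_vector_mult_diff_distrib)
  ultimately have "((\<lambda>j. Hinv (z j) (w j) - Hinv z0 w0) \<longlongrightarrow> 0) F"
    using Lim_null_comparison[of "\<lambda>j. Hinv (z j) (w j) - Hinv z0 w0"
        "\<lambda>j. norm (w j - Hyy (z j) *v Hinv z0 w0) / \<mu>" F] by simp
  then show ?thesis by (simp add: LIM_zero_iff)
qed

definition newton :: "('n, 'p) point \<Rightarrow> real^'p" where "newton z = Hinv z (gy z)"

lemma Amap_eq: "Amap Hyy gy z = snd z - newton z"
  by (simp add: Amap_def newton_def Hinv_def)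

lemma newton_tendsto: "(z \<longlongrightarrow> z0) F \<Longrightarrow> ((\<lambda>j. newton (z j)) \<longlongrightarrow> newton z0) F"
  unfolding newton_def by (intro Hinv_tendsto gy_tendsto)

lemma norm_newton: "norm (newton z) \<le> norm (gy z) / \<mu>"
  unfolding newton_def by (rule norm_Hinv)

lemma newton_diff_linearization:
  "norm (newton z' - newton z - Hinv z (gy z' - gy z)) \<le> Qg / \<mu> * norm (newton z') * norm (z' - z)"
proof -
  have "Hyy z *v (newton z' - newton z - Hinv z (gy z' - gy z)) = - ((Hyy z' - Hyy z) *v newton z')"
    by (simp add: matrix_vector_mult_diff_distrib matrix_vector_mult_diff_rdistrib newton_def)
  then have "norm (newton z' - newton z - Hinv z (gy z' - gy z))
    \<le> norm ((Hyy z' - Hyy z) *v newton z') / \<mu>"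
    using norm_le_Hyy[of "newton z' - newton z - Hinv z (gy z' - gy z)" z] by simp
  also have "\<dots> \<le> Qg * norm (z' - z) * norm (newton z') / \<mu>"
    using \<mu>_pos by (intro divide_right_mono norm_Hyy_diff_mult) auto
  finally show ?thesis by (simp add: ac_simps)
qed

lemma gy_bounded_on:
  assumes "bounded S"
  shows "\<exists>B\<ge>0. \<forall>z\<in>S. norm (gy z) \<le> B"
proof -
  have "bounded (gy ` S)"
    by (rule bounded_uniformly_continuous_image[OF lipschitz_on_uniformly_continuous assms])
      (rule lipschitz_on_subset[OF gy_lipschitz subset_UNIV])
  then show ?thesis unfolding bounded_pos by (auto intro: less_imp_le)
qed

lemma newton_lipschitz_on:
  assumes "bounded S"
  shows "\<exists>L. L-lipschitz_on S newton"
proof -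
  obtain B where B: "0 \<le> B" "\<And>z. z \<in> S \<Longrightarrow> norm (gy z) \<le> B" using gy_bounded_on[OF assms] by blast
  have "(Lg / \<mu> + Qg / \<mu> * (B / \<mu>))-lipschitz_on S newton"
  proof (rule lipschitz_onI)
    fix z z' assume z: "z \<in> S" "z' \<in> S"
    have "norm (newton z) \<le> B / \<mu>"
      using norm_newton[of z] divide_right_mono[OF B(2)[OF z(1)], of \<mu>] \<mu>_pos by simp
    then have "Qg / \<mu> * norm (newton z) * norm (z - z') \<le> Qg / \<mu> * (B / \<mu>) * norm (z - z')"
      using Qg_pos \<mu>_pos by (intro mult_right_mono mult_left_mono) auto
    moreover have "norm (Hinv z' (gy z - gy z')) \<le> Lg / \<mu> * norm (z - z')"
      using norm_Hinv[of z' "gy z - gy z'"]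
        divide_right_mono[OF norm_gy_diff_le, of \<mu> z z'] \<mu>_pos by simp
    moreover have "norm (newton z - newton z')
        \<le> norm (Hinv z' (gy z - gy z')) + norm (newton z - newton z' - Hinv z' (gy z - gy z'))"
      using norm_triangle_ineq[of "Hinv z' (gy z - gy z')" "newton z - newton z' - Hinv z' (gy z - gy z')"]
      by simp
    ultimately show "dist (newton z) (newton z') \<le> (Lg / \<mu> + Qg / \<mu> * (B / \<mu>)) * dist z z'"
      using newton_diff_linearization[of z z'] by (simp add: dist_norm distrib_right)
  qed (use B(1) Lg_pos Qg_pos \<mu>_pos in simp)
  then show ?thesis ..
qed

text \<open>\<open>Hyy\<close> is never differentiated: its Lipschitz bound controls the unknown part of the derivative.\<close>
lemma norm_newton_derivative_error:
  assumes \<sigma>: "(\<sigma> has_vector_derivative u) (at t)"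
    and newton: "((\<lambda>s. newton (\<sigma> s)) has_vector_derivative n) (at t)"
  shows "norm (n - Hinv (\<sigma> t) (dgy (\<sigma> t) u)) \<le> Qg / \<mu> * norm (newton (\<sigma> t)) * norm u"
proof (rule norm_vector_derivative_le[OF _ \<sigma>])
  have "bounded_linear (Hinv (\<sigma> t))" using linear_Hinv by (simp add: linear_conv_bounded_linear)
  then show "((\<lambda>s. newton (\<sigma> s) - Hinv (\<sigma> t) (gy (\<sigma> s)))
      has_vector_derivative n - Hinv (\<sigma> t) (dgy (\<sigma> t) u)) (at t)"
    by (rule has_vector_derivative_diff[OF newton
          bounded_linear.has_vector_derivative[OF _ gy_along_curve[OF \<sigma>]]])
  show "norm (newton (\<sigma> s) - Hinv (\<sigma> t) (gy (\<sigma> s)) - (newton (\<sigma> t) - Hinv (\<sigma> t) (gy (\<sigma> t))))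
      \<le> Qg / \<mu> * norm (newton (\<sigma> s)) * norm (\<sigma> s - \<sigma> t)" for s
    using newton_diff_linearization[of "\<sigma> s" "\<sigma> t"] by (simp add: Hinv_linear_simps algebra_simps)
  show "((\<lambda>s. Qg / \<mu> * norm (newton (\<sigma> s))) \<longlongrightarrow> Qg / \<mu> * norm (newton (\<sigma> t))) (at t)"
    using has_vector_derivative_continuous[OF newton]
    by (intro tendsto_intros) (simp add: continuous_within)
qed

end

section \<open>The Lyapunov function\<close>

lemma powr_seven_halves: "0 < \<mu> \<Longrightarrow> (\<mu>::real) powr 3.5 = \<mu> ^ 3 * sqrt \<mu>"
  using powr_add[of \<mu> 3 "1 / 2"] by (simp add: powr_half_sqrt powr_numeral)

lemma lyapunov_error_le:
  fixes a b :: real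
  assumes pos: "0 < C" "0 < \<mu>" "0 < L" "\<mu> \<le> L" "0 \<le> a" "0 \<le> b"
    and beta: "8 * C / \<mu> ^ 3 \<le> \<beta>" "4 * C * L / \<mu> powr 3.5 \<le> \<beta>"
  shows "C / \<mu>\<^sup>2 * b * (a + \<beta> * b + L / \<mu> * a) \<le> (a\<^sup>2 + \<beta>\<^sup>2 * \<mu> * b\<^sup>2) / 2"
proof -
  have "0 < 8 * C / \<mu> ^ 3" using pos by simp
  then have \<beta>: "0 < \<beta>" using beta(1) by linarith
  have "C / \<mu>\<^sup>2 \<le> \<beta> * \<mu> / 8"
    using beta(1) pos by (simp add: field_simps power2_eq_square power3_eq_cube)
  then have "C / \<mu>\<^sup>2 * (\<beta> * b\<^sup>2) \<le> \<beta> * \<mu> / 8 * (\<beta> * b\<^sup>2)"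
    using \<beta> by (intro mult_right_mono) auto
  then have square_term: "C / \<mu>\<^sup>2 * (\<beta> * b\<^sup>2) \<le> \<beta>\<^sup>2 * \<mu> * b\<^sup>2 / 8"
    by (simp add: power2_eq_square ac_simps)
  define s where "s = sqrt \<mu>"
  have s: "0 < s" "s\<^sup>2 = \<mu>" using pos by (auto simp: s_def)
  have "2 * (C * L) / \<mu> ^ 3 \<le> \<beta> * s / 2"
    using beta(2) pos s powr_seven_halves[of \<mu>] by (simp add: field_simps flip: s_def)
  moreover have "1 + L / \<mu> \<le> 2 * (L / \<mu>)" using pos by (simp add: field_simps)
  then have "C / \<mu>\<^sup>2 * (1 + L / \<mu>) \<le> 2 * (C * L) / \<mu> ^ 3"
    using mult_left_mono[of "1 + L / \<mu>" "2 * (L / \<mu>)" "C / \<mu>\<^sup>2"] pos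
    by (simp add: power2_eq_square power3_eq_cube ac_simps)
  ultimately have "C / \<mu>\<^sup>2 * (1 + L / \<mu>) \<le> \<beta> * s / 2" by (rule order_trans[rotated])
  then have "C / \<mu>\<^sup>2 * (1 + L / \<mu>) * (a * b) \<le> \<beta> * s / 2 * (a * b)"
    using pos by (intro mult_right_mono) auto
  also have "\<dots> \<le> (a\<^sup>2 + \<beta>\<^sup>2 * \<mu> * b\<^sup>2) / 4"
    using sum_squares_bound[of a "\<beta> * s * b"] s(2) by (simp add: power_mult_distrib ac_simps)
  finally have cross_term: "C / \<mu>\<^sup>2 * (1 + L / \<mu>) * (a * b) \<le> (a\<^sup>2 + \<beta>\<^sup>2 * \<mu> * b\<^sup>2) / 4" .
  have "C / \<mu>\<^sup>2 * b * (a + \<beta> * b + L / \<mu> * a)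
      = C / \<mu>\<^sup>2 * (\<beta> * b\<^sup>2) + C / \<mu>\<^sup>2 * (1 + L / \<mu>) * (a * b)"
    by (simp add: algebra_simps power2_eq_square add_divide_distrib)
  also have "\<dots> \<le> \<beta>\<^sup>2 * \<mu> * b\<^sup>2 / 8 + (a\<^sup>2 + \<beta>\<^sup>2 * \<mu> * b\<^sup>2) / 4"
    by (rule add_mono[OF square_term cross_term])
  also have "\<dots> \<le> (a\<^sup>2 + \<beta>\<^sup>2 * \<mu> * b\<^sup>2) / 2"
  proof -
    have sum_le: "Y / 8 + (X + Y) / 4 \<le> (X + Y) / 2" if "0 \<le> X" "0 \<le> Y" for X Y :: real
      using that by (simp add: field_simps)
    show ?thesis by (rule sum_le) (use pos in simp_all)
  qed
  finally show ?thesis .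
qed

lemma lipschitz_on_power2_norm:
  assumes F: "L-lipschitz_on S F" and bound: "\<And>x. x \<in> S \<Longrightarrow> norm (F x) \<le> B" and "0 \<le> B"
  shows "(2 * B * L)-lipschitz_on S (\<lambda>x. (norm (F x))\<^sup>2)"
proof (rule lipschitz_onI)
  fix x y assume xy: "x \<in> S" "y \<in> S"
  have "\<bar>(norm (F x))\<^sup>2 - (norm (F y))\<^sup>2\<bar> = \<bar>norm (F x) + norm (F y)\<bar> * \<bar>norm (F x) - norm (F y)\<bar>"
    by (simp add: power2_eq_square square_diff_square_factored abs_mult)
  also have "\<dots> \<le> (B + B) * (L * dist x y)"
  proof (rule mult_mono)
    show "\<bar>norm (F x) + norm (F y)\<bar> \<le> B + B" using bound[OF xy(1)] bound[OF xy(2)] by simp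
    show "\<bar>norm (F x) - norm (F y)\<bar> \<le> L * dist x y"
      using norm_triangle_ineq3[of "F x" "F y"] lipschitz_onD[OF F xy] by (simp add: dist_norm)
  qed (use \<open>0 \<le> B\<close> in auto)
  finally show "dist ((norm (F x))\<^sup>2) ((norm (F y))\<^sup>2) \<le> 2 * B * L * dist x y"
    by (simp add: dist_real_def)
qed (use \<open>0 \<le> B\<close> lipschitz_on_nonneg[OF F] in simp)

lemma inner_le_field_integrand:
  assumes \<gamma>: "(\<gamma> has_vector_derivative u) (at t)" and "bounded (D (\<gamma> t))" "d \<in> D (\<gamma> t)"
  shows "u \<bullet> d \<le> field_integrand D \<gamma> t"
proof -
  have "bounded ((\<lambda>v. u \<bullet> v) ` D (\<gamma> t))"
    by (rule bounded_linear_image[OF assms(2) bounded_linear_inner_right])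
  then show ?thesis
    unfolding field_integrand_def vector_derivative_at[OF \<gamma>]
    using assms(3) by (intro cSup_upper bounded_imp_bdd_above) auto
qed

locale bilevel = lower_level g gx gy Hxy Hyy \<mu> Lg Qg
  for g :: "('n::finite, 'p::finite) point \<Rightarrow> real" and gx gy Hxy Hyy \<mu> Lg Qg +
  fixes f :: "('n, 'p) point \<Rightarrow> real"
    and Df :: "('n, 'p) point \<Rightarrow> ('n, 'p) point set"
    and Mf \<beta> :: real
  assumes Mf_pos: "0 < Mf"
    and f_lip: "Mf-lipschitz_on UNIV f"
    and Df_cons: "conservative_field Df"
    and f_pot: "potential_of f Df"
    and Df_convex: "\<And>z. convex (Df z)"
    and Df_bound: "\<And>z d. d \<in> Df z \<Longrightarrow> norm d \<le> Mf"
    and beta: "\<beta> \<ge> max (8 * Mf * Qg / \<mu> ^ 3) (4 * Mf * Qg * Lg / \<mu> powr 3.5)"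
begin

abbreviation lyapunov :: "('n, 'p) point \<Rightarrow> real"
  where "lyapunov \<equiv> hfun f \<beta> Hyy gy"

lemma \<beta>_pos: "0 < \<beta>"
proof -
  have "0 < 8 * Mf * Qg / \<mu> ^ 3" using Mf_pos Qg_pos \<mu>_pos by simp
  then show ?thesis using beta by linarith
qed

lemma Df_compact: "compact (Df z)" and Df_graph: "closed {(z, d). d \<in> Df z}"
  using Df_cons unfolding conservative_field_def by blast+

definition newton_point :: "('n, 'p) point \<Rightarrow> ('n, 'p) point"
  where "newton_point z = (fst z, Amap Hyy gy z)"

definition hypergradient :: "('n, 'p) point \<Rightarrow> ('n, 'p) point \<Rightarrow> real^'n"
  where "hypergradient z d = fst d - Hxy z *v Hinv z (snd d)"

definition lifted_hypergradient ::
  "('n, 'p) point \<Rightarrow> ('n, 'p) point \<Rightarrow> ('n, 'p) point"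
  where "lifted_hypergradient z d = (hypergradient z d, - Hinv z (hypergradient z d v* Hxy z))"

definition direction :: "('n, 'p) point \<Rightarrow> ('n, 'p) point \<Rightarrow> ('n, 'p) point"
  where "direction z d = (0, \<beta> *\<^sub>R gy z) + lifted_hypergradient z d"

definition directions :: "('n, 'p) point \<Rightarrow> ('n, 'p) point set"
  where "directions z = direction z ` Df (newton_point z)"

definition energy :: "('n, 'p) point \<Rightarrow> real"
  where "energy z = \<beta> / 2 * (norm (gy z))\<^sup>2"

definition dissipation :: "('n, 'p) point \<Rightarrow> ('n, 'p) point \<Rightarrow> real"
  where "dissipation z d = ((norm (hypergradient z d))\<^sup>2 + \<beta>\<^sup>2 * \<mu> * (norm (gy z))\<^sup>2) / 2"

lemma newton_point_eq: "newton_point z = z - (0, newton z)"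
  by (simp add: newton_point_def Amap_eq prod_eq_iff)

lemma newton_point_tendsto: "(z \<longlongrightarrow> z0) F \<Longrightarrow> ((\<lambda>j. newton_point (z j)) \<longlongrightarrow> newton_point z0) F"
  unfolding newton_point_eq by (intro tendsto_diff tendsto_Pair tendsto_const newton_tendsto)

lemma newton_point_eq_self: "gy z = 0 \<Longrightarrow> newton_point z = z"
  by (simp add: newton_point_eq newton_def Hinv_linear_simps zero_prod_def[symmetric])

lemma direction_tendsto:
  assumes z: "(z \<longlongrightarrow> z0) F" and d: "(d \<longlongrightarrow> d0) F"
  shows "((\<lambda>j. direction (z j) (d j)) \<longlongrightarrow> direction z0 d0) F"
proof -
  have "((\<lambda>j. hypergradient (z j) (d j)) \<longlongrightarrow> hypergradient z0 d0) F"
    unfolding hypergradient_def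
    by (intro tendsto_diff tendsto_matrix_vector_mult Hxy_tendsto Hinv_tendsto tendsto_fst tendsto_snd z d)
  then show ?thesis
    unfolding direction_def lifted_hypergradient_def
    by (intro tendsto_add tendsto_Pair tendsto_scaleR tendsto_const tendsto_minus
        gy_tendsto Hinv_tendsto tendsto_vector_matrix_mult Hxy_tendsto z)
qed

lemma norm_hypergradient: "norm (hypergradient z d) \<le> (1 + Lg / \<mu>) * norm d"
proof -
  have "norm (hypergradient z d) \<le> norm (fst d) + norm (Hxy z *v Hinv z (snd d))"
    unfolding hypergradient_def by (rule norm_triangle_ineq4)
  also have "\<dots> \<le> norm (fst d) + Lg * (norm (snd d) / \<mu>)"
    using norm_Hxy[of z "Hinv z (snd d)"]
      mult_left_mono[OF norm_Hinv[of z "snd d"], of Lg] Lg_pos by simp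
  also have "\<dots> \<le> norm d + Lg * (norm d / \<mu>)"
    using Lg_pos \<mu>_pos norm_fst_le[of "fst d" "snd d"] norm_snd_le[of "snd d" "fst d"]
    by (intro add_mono mult_left_mono divide_right_mono) auto
  finally show ?thesis by (simp add: algebra_simps)
qed

lemma norm_direction:
  "norm (direction z d) \<le> norm (hypergradient z d) + \<beta> * norm (gy z) + Lg / \<mu> * norm (hypergradient z d)"
proof -
  let ?p = "hypergradient z d"
  have "norm (direction z d) \<le> norm (0::real^'n, \<beta> *\<^sub>R gy z) + norm (lifted_hypergradient z d)"
    unfolding direction_def by (rule norm_triangle_ineq)
  also have "norm (0::real^'n, \<beta> *\<^sub>R gy z) = \<beta> * norm (gy z)" using \<beta>_pos by (simp add: norm_Pair)
  also have "norm (lifted_hypergradient z d) \<le> norm ?p + norm (Hinv z (?p v* Hxy z))"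
    unfolding lifted_hypergradient_def using norm_Pair_le[of ?p "- Hinv z (?p v* Hxy z)"] by simp
  also have "norm (Hinv z (?p v* Hxy z)) \<le> Lg / \<mu> * norm ?p"
    using norm_Hinv[of z "?p v* Hxy z"]
      divide_right_mono[OF norm_vector_Hxy[of ?p z], of \<mu>] \<mu>_pos by simp
  finally show ?thesis by simp
qed

lemma linear_lifted_hypergradient: "linear (lifted_hypergradient z)"
proof -
  have "hypergradient z (d + e) = hypergradient z d + hypergradient z e"
    "hypergradient z (c *\<^sub>R d) = c *\<^sub>R hypergradient z d" for d e c
    by (simp_all add: hypergradient_def Hinv_linear_simps matrix_vector_right_distrib
        matrix_vector_mult_scaleR scaleR_diff_right)
  then show ?thesis
    by (intro linearI) (simp_all add: lifted_hypergradient_def Hinv_linear_simps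
        vector_matrix_left_distrib scaleR_vector_matrix_assoc)
qed

lemma directions_eq: "directions z = (+) (0, \<beta> *\<^sub>R gy z) ` lifted_hypergradient z ` Df (newton_point z)"
  by (simp add: directions_def direction_def image_image)

lemma convex_directions: "convex (directions z)"
  unfolding directions_eq
  by (intro convex_translation convex_linear_image[OF linear_lifted_hypergradient] Df_convex)

lemma closed_directions: "closed (directions z)"
  unfolding directions_eq
  by (intro compact_imp_closed compact_translation compact_continuous_image Df_compact
      linear_continuous_on linear_conv_bounded_linear[THEN iffD1] linear_lifted_hypergradient)

lemma directions_limit:
  assumes z: "z \<longlonglongrightarrow> z0" and c: "c \<longlonglongrightarrow> newton_point z0"
    and d: "\<And>j. d j \<in> Df (c j)" and u: "(\<lambda>j::nat. direction (z j) (d j)) \<longlonglongrightarrow> u"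
  shows "u \<in> directions z0"
proof -
  have "bounded (range d)" by (rule boundedI[of _ Mf]) (use d Df_bound in blast)
  then obtain d0 r where r: "strict_mono r" "(d \<circ> r) \<longlonglongrightarrow> d0"
    using bounded_imp_convergent_subsequence by blast
  have "(\<lambda>j. (c (r j), d (r j))) \<longlonglongrightarrow> (newton_point z0, d0)"
    using LIMSEQ_subseq_LIMSEQ[OF c r(1)] r(2) by (intro tendsto_Pair) (auto simp: o_def)
  then have "(newton_point z0, d0) \<in> {(z, d). d \<in> Df z}"
    by (rule closed_sequentially[OF Df_graph, rotated]) (use d in auto)
  moreover have "(\<lambda>j. direction (z (r j)) (d (r j))) \<longlonglongrightarrow> direction z0 d0"
    using LIMSEQ_subseq_LIMSEQ[OF z r(1)] r(2) by (intro direction_tendsto) (auto simp: o_def)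
  then have "u = direction z0 d0"
    using LIMSEQ_subseq_LIMSEQ[OF u r(1)] LIMSEQ_unique by (auto simp: o_def)
  ultimately show ?thesis by (simp add: directions_def)
qed

lemma direction_eq_0_iff: "direction z d = 0 \<longleftrightarrow> hypergradient z d = 0 \<and> gy z = 0"
  using \<beta>_pos by (auto simp: direction_def lifted_hypergradient_def zero_prod_def Hinv_linear_simps)

lemma zero_in_directions_iff: "0 \<in> directions z \<longleftrightarrow> BLO_stationary Df Hxy Hyy gy z"
proof -
  have "0 \<in> directions z \<longleftrightarrow> (\<exists>d\<in>Df (newton_point z). hypergradient z d = 0 \<and> gy z = 0)"
    unfolding directions_def direction_eq_0_iff[symmetric] by (auto simp: image_iff)
  also have "\<dots> \<longleftrightarrow> (\<exists>d\<in>Df z. hypergradient z d = 0) \<and> gy z = 0"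
    using newton_point_eq_self[of z] by (cases "gy z = 0") simp_all
  also have "\<dots> \<longleftrightarrow> BLO_stationary Df Hxy Hyy gy z"
    by (auto simp: BLO_stationary_def hypergradient_def Hinv_def Bex_def)
  finally show ?thesis .
qed

lemma closed_stationary: "closed {z. 0 \<in> directions z}"
  unfolding closed_sequential_limits
proof (intro allI impI, elim conjE)
  fix z z0 assume stationary: "\<forall>j. z j \<in> {z. 0 \<in> directions z}" and z: "z \<longlonglongrightarrow> z0"
  then have "\<exists>d. d \<in> Df (newton_point (z j)) \<and> direction (z j) d = 0" for j
    unfolding directions_def by (metis (mono_tags, lifting) imageE mem_Collect_eq)
  then obtain d where d: "\<And>j. d j \<in> Df (newton_point (z j))" "\<And>j. direction (z j) (d j) = 0" by metis
  show "z0 \<in> {z. 0 \<in> directions z}"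
    using directions_limit[OF z newton_point_tendsto[OF z] d(1)] d(2) by simp
qed

lemma lyapunov_eq: "lyapunov z = f (newton_point z) + energy z"
  by (simp add: hfun_def newton_point_def energy_def)

lemma lyapunov_stationary: "BLO_stationary Df Hxy Hyy gy z \<Longrightarrow> lyapunov z = f z"
  by (auto simp: BLO_stationary_def lyapunov_eq energy_def newton_point_eq_self)

lemma lyapunov_continuous: "continuous_on UNIV (lyapunov)"
  unfolding continuous_on_def
proof
  fix z0
  have "((\<lambda>z. f (newton_point z)) \<longlongrightarrow> f (newton_point z0)) (at z0)"
    by (rule continuous_on_tendsto_compose[OF lipschitz_on_continuous_on[OF f_lip] newton_point_tendsto])
      (auto intro: tendsto_ident_at)
  then show "(lyapunov \<longlongrightarrow> lyapunov z0) (at z0)"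
    unfolding lyapunov_eq energy_def by (intro tendsto_intros gy_tendsto)
qed

lemma lifted_hypergradient_inner: "lifted_hypergradient z d \<bullet> d = (norm (hypergradient z d))\<^sup>2"
proof -
  have "Hinv z (hypergradient z d v* Hxy z) \<bullet> snd d = hypergradient z d \<bullet> (Hxy z *v Hinv z (snd d))"
    by (simp add: Hinv_symmetric dot_lmul_matrix)
  then have "lifted_hypergradient z d \<bullet> d = hypergradient z d \<bullet> (fst d - Hxy z *v Hinv z (snd d))"
    by (simp add: lifted_hypergradient_def inner_prod_def inner_diff_right)
  then show ?thesis by (simp add: hypergradient_def power2_norm_eq_inner)
qed

lemma dgy_direction: "dgy z (T *\<^sub>R direction z d) = (T * \<beta>) *\<^sub>R (Hyy z *v gy z)"
  by (simp add: dgy_def direction_def lifted_hypergradient_def scaleR_vector_matrix_assoc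
      matrix_vector_mult_scaleR matrix_vector_mult_diff_distrib scaleR_diff_right)

lemma norm_newton_point_derivative_error:
  assumes \<sigma>: "(\<sigma> has_vector_derivative T *\<^sub>R direction (\<sigma> t) d) (at t)"
    and c: "((\<lambda>s. newton_point (\<sigma> s)) has_vector_derivative c') (at t)"
  shows "norm (c' - T *\<^sub>R lifted_hypergradient (\<sigma> t) d)
    \<le> Qg / \<mu> * norm (newton (\<sigma> t)) * norm (T *\<^sub>R direction (\<sigma> t) d)"
proof -
  let ?u = "T *\<^sub>R direction (\<sigma> t) d"
  have difference: "((\<lambda>s. \<sigma> s - newton_point (\<sigma> s)) has_vector_derivative ?u - c') (at t)"
    by (rule has_vector_derivative_diff[OF \<sigma> c])
  have newton: "((\<lambda>s. newton (\<sigma> s)) has_vector_derivative snd (?u - c')) (at t)"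
    using bounded_linear.has_vector_derivative[OF bounded_linear_snd difference]
    by (simp add: newton_point_eq)
  have "((\<lambda>s. 0) has_vector_derivative fst (?u - c')) (at t)"
    using bounded_linear.has_vector_derivative[OF bounded_linear_fst difference]
    by (simp add: newton_point_eq)
  then have "fst (?u - c') = 0"
    using vector_derivative_unique_at has_vector_derivative_const by blast
  then have "c' - T *\<^sub>R lifted_hypergradient (\<sigma> t) d
    = (0, - (snd (?u - c') - Hinv (\<sigma> t) (dgy (\<sigma> t) ?u)))"
    unfolding dgy_direction by (simp add: prod_eq_iff direction_def Hinv_linear_simps scaleR_add_right)
  then have "norm (c' - T *\<^sub>R lifted_hypergradient (\<sigma> t) d)
    = norm (snd (?u - c') - Hinv (\<sigma> t) (dgy (\<sigma> t) ?u))"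
    by (simp only: norm_Pair norm_minus_cancel) simp
  then show ?thesis using norm_newton_derivative_error[OF \<sigma> newton] by simp
qed

definition lyapunov_rate :: "(real \<Rightarrow> ('n, 'p) point) \<Rightarrow> real \<Rightarrow> real"
  where "lyapunov_rate \<sigma> t = field_integrand Df (\<lambda>s. newton_point (\<sigma> s)) t
    + \<beta> * (gy (\<sigma> t) \<bullet> dgy (\<sigma> t) (vector_derivative \<sigma> (at t)))"

lemma dissipation_le_lyapunov_rate:
  assumes \<sigma>: "(\<sigma> has_vector_derivative T *\<^sub>R direction (\<sigma> t) d) (at t)" and T: "0 < T"
    and c: "(\<lambda>s. newton_point (\<sigma> s)) differentiable (at t)" and d: "d \<in> Df (newton_point (\<sigma> t))"
  shows "T * dissipation (\<sigma> t) d \<le> lyapunov_rate \<sigma> t"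
proof -
  let ?z = "\<sigma> t" and ?c = "\<lambda>s. newton_point (\<sigma> s)"
  let ?a = "norm (hypergradient ?z d)" and ?b = "norm (gy ?z)"
  obtain c' where c': "(?c has_vector_derivative c') (at t)" using c vector_derivative_works by blast
  define e where "e = c' - T *\<^sub>R lifted_hypergradient ?z d"
  have "norm e \<le> Qg / \<mu> * norm (newton ?z) * norm (T *\<^sub>R direction ?z d)"
    unfolding e_def by (rule norm_newton_point_derivative_error[OF \<sigma> c'])
  also have "\<dots> \<le> Qg / \<mu> * (?b / \<mu>) * (T * (?a + \<beta> * ?b + Lg / \<mu> * ?a))"
    using norm_newton[of ?z] norm_direction[of ?z d] T Qg_pos \<mu>_pos by (intro mult_mono) auto
  finally have norm_e: "norm e \<le> Qg / \<mu> * (?b / \<mu>) * (T * (?a + \<beta> * ?b + Lg / \<mu> * ?a))" .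
  have "- (e \<bullet> d) \<le> norm e * norm d" using norm_cauchy_schwarz[of "- e" d] by simp
  also have "\<dots> \<le> norm e * Mf" using Df_bound[OF d] by (simp add: mult_left_mono)
  also have "\<dots> \<le> Qg / \<mu> * (?b / \<mu>) * (T * (?a + \<beta> * ?b + Lg / \<mu> * ?a)) * Mf"
    by (rule mult_right_mono[OF norm_e less_imp_le[OF Mf_pos]])
  also have "\<dots> = T * (Mf * Qg / \<mu>\<^sup>2 * ?b * (?a + \<beta> * ?b + Lg / \<mu> * ?a))"
    by (simp add: power2_eq_square)
  also have "\<dots> \<le> T * dissipation ?z d"
    unfolding dissipation_def using T Mf_pos Qg_pos \<mu>_pos Lg_pos \<mu>_le_Lg beta
    by (intro mult_left_mono lyapunov_error_le) (auto simp: mult.assoc)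
  finally have error: "- (e \<bullet> d) \<le> T * dissipation ?z d" .
  have "c' \<bullet> d \<le> field_integrand Df ?c t"
    using inner_le_field_integrand[OF c', of Df d] d Df_compact by (simp add: compact_imp_bounded)
  moreover have "c' \<bullet> d = T * ?a\<^sup>2 + e \<bullet> d"
    by (simp add: e_def inner_diff_left lifted_hypergradient_inner)
  moreover have "T * \<beta>\<^sup>2 * (\<mu> * ?b\<^sup>2) \<le> T * \<beta>\<^sup>2 * (gy ?z \<bullet> (Hyy ?z *v gy ?z))"
    using T Hyy_pd[of "gy ?z" ?z] by (intro mult_left_mono) auto
  moreover have "\<dots> = \<beta> * (gy ?z \<bullet> dgy ?z (vector_derivative \<sigma> (at t)))"
    unfolding vector_derivative_at[OF \<sigma>] dgy_direction by (simp add: power2_eq_square)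
  moreover have "2 * (T * dissipation ?z d) = T * ?a\<^sup>2 + T * \<beta>\<^sup>2 * (\<mu> * ?b\<^sup>2)"
    by (simp add: dissipation_def algebra_simps)
  ultimately show ?thesis using error unfolding lyapunov_rate_def by linarith
qed

lemma dissipation_nonneg: "0 \<le> dissipation z d"
  using \<mu>_pos by (simp add: dissipation_def)

lemma dissipation_pos:
  assumes "direction z d \<noteq> 0"
  shows "0 < dissipation z d"
proof -
  have "dissipation z d \<noteq> 0"
    using assms \<beta>_pos \<mu>_pos unfolding direction_eq_0_iff dissipation_def
    by (auto simp: add_nonneg_eq_0_iff)
  then show ?thesis using dissipation_nonneg[of z d] by simp
qed

lemma energy_lipschitz_on:
  assumes "bounded S"
  shows "\<exists>L. L-lipschitz_on S energy"
proof -
  obtain B where B: "0 \<le> B" "\<forall>z\<in>S. norm (gy z) \<le> B" using gy_bounded_on[OF assms] by blast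
  have "(\<beta> / 2 * (2 * B * Lg))-lipschitz_on S energy"
    using B \<beta>_pos unfolding energy_def
    by (intro lipschitz_on_cmult_real_nonneg lipschitz_on_power2_norm
        lipschitz_on_subset[OF gy_lipschitz]) auto
  then show ?thesis ..
qed

lemma newton_point_lipschitz_on:
  assumes "bounded S"
  shows "\<exists>L. L-lipschitz_on S newton_point"
proof -
  obtain L where "L-lipschitz_on S newton" using newton_lipschitz_on[OF assms] by blast
  then have "(1 + sqrt (0\<^sup>2 + L\<^sup>2))-lipschitz_on S (\<lambda>z. z - (0, newton z))"
    by (intro lipschitz_on_diff lipschitz_on_Pair lipschitz_on_id lipschitz_on_constant)
  then show ?thesis unfolding newton_point_eq[abs_def] by blast
qed

lemma energy_along_curve:
  assumes "(\<sigma> has_vector_derivative u) (at t)"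
  shows "((\<lambda>s. energy (\<sigma> s)) has_real_derivative \<beta> * (gy (\<sigma> t) \<bullet> dgy (\<sigma> t) u)) (at t)"
proof -
  note gy = gy_along_curve[OF assms]
  have "((\<lambda>s. gy (\<sigma> s) \<bullet> gy (\<sigma> s)) has_real_derivative
      gy (\<sigma> t) \<bullet> dgy (\<sigma> t) u + dgy (\<sigma> t) u \<bullet> gy (\<sigma> t)) (at t)"
    using bounded_bilinear.has_vector_derivative[OF bounded_bilinear_inner gy gy]
    by (simp add: has_real_derivative_iff_has_vector_derivative)
  from DERIV_cmult[OF this, of "\<beta> / 2"] show ?thesis
    by (simp add: energy_def power2_norm_eq_inner inner_commute)
qed

lemma lyapunov_increment_integral:
  assumes \<sigma>: "K-lipschitz_on UNIV \<sigma>" and "bounded (range \<sigma>)"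
  obtains N where "negligible N"
    "\<forall>t. t \<notin> N \<longrightarrow> \<sigma> differentiable (at t) \<and> (\<lambda>s. newton_point (\<sigma> s)) differentiable (at t)"
    "(lyapunov_rate \<sigma> has_integral (lyapunov (\<sigma> 1) - lyapunov (\<sigma> 0))) {0..1}"
proof -
  let ?c = "\<lambda>s. newton_point (\<sigma> s)" and ?E = "\<lambda>s. energy (\<sigma> s)"
  obtain L where "L-lipschitz_on (range \<sigma>) newton_point"
    using newton_point_lipschitz_on[OF assms(2)] by blast
  then have L: "(L * K)-lipschitz_on UNIV ?c" by (rule lipschitz_on_compose2[OF \<sigma>])
  obtain M where "M-lipschitz_on (range \<sigma>) energy"
    using energy_lipschitz_on[OF assms(2)] by blast
  then have M: "(M * K)-lipschitz_on UNIV ?E" by (rule lipschitz_on_compose2[OF \<sigma>])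
  define N where "N = {t. \<not> \<sigma> differentiable (at t)} \<union> {t. \<not> ?c differentiable (at t)}"
  have N: "negligible N"
    unfolding N_def
    by (intro negligible_Un lipschitz_differentiable_ae[OF \<sigma>] lipschitz_differentiable_ae[OF L])
  have derivative: "(\<sigma> has_vector_derivative vector_derivative \<sigma> (at t)) (at t)" if "t \<notin> N" for t
    using that vector_derivative_works[of \<sigma> "at t"] by (simp add: N_def)
  have energy: "((\<lambda>t. \<beta> * (gy (\<sigma> t) \<bullet> dgy (\<sigma> t) (vector_derivative \<sigma> (at t))))
      has_integral (?E 1 - ?E 0)) {0..1}"
    by (rule lipschitz_has_integral_derivative[OF M _ N]) (use energy_along_curve[OF derivative] in auto)
  have "abs_cont_01 ?c" by (rule lipschitz_imp_abs_cont_01[OF lipschitz_on_subset[OF L subset_UNIV]])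
  then have potential: "(field_integrand Df ?c has_integral (f (?c 1) - f (?c 0))) {0..1}"
    using f_pot unfolding potential_of_def by blast
  have "f (?c 1) - f (?c 0) + (?E 1 - ?E 0) = lyapunov (\<sigma> 1) - lyapunov (\<sigma> 0)"
    by (simp add: lyapunov_eq)
  then have "(lyapunov_rate \<sigma> has_integral (lyapunov (\<sigma> 1) - lyapunov (\<sigma> 0))) {0..1}"
    using has_integral_add[OF potential energy] unfolding lyapunov_rate_def[abs_def] by (rule subst)
  then show thesis by (rule that[OF N, rotated]) (simp add: N_def)
qed

end

definition reversal :: "real \<Rightarrow> (real \<Rightarrow> 'a) \<Rightarrow> real \<Rightarrow> 'a" where
  "reversal T \<gamma> t = \<gamma> (T * (1 - max 0 (min 1 t)))"

lemma reversal_0 [simp]: "reversal T \<gamma> 0 = \<gamma> T" and reversal_1 [simp]: "reversal T \<gamma> 1 = \<gamma> 0"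
  by (simp_all add: reversal_def)

lemma reversal_in_interval:
  fixes t :: real
  shows "0 < T \<Longrightarrow> T * (1 - max 0 (min 1 t)) \<in> {0..T}"
  by (auto intro: mult_left_le)

lemma range_reversal_subset: "0 < T \<Longrightarrow> range (reversal T \<gamma>) \<subseteq> \<gamma> ` {0..T}"
  using reversal_in_interval by (auto simp: reversal_def)

lemma lipschitz_reversal:
  assumes \<gamma>: "L-lipschitz_on {0..T} \<gamma>" and T: "0 < T"
  shows "(L * T)-lipschitz_on UNIV (reversal T \<gamma>)"
proof (rule lipschitz_onI)
  fix s t :: real
  have "dist (reversal T \<gamma> s) (reversal T \<gamma> t)
      \<le> L * dist (T * (1 - max 0 (min 1 s))) (T * (1 - max 0 (min 1 t)))"
    unfolding reversal_def by (intro lipschitz_onD[OF \<gamma>] reversal_in_interval[OF T])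
  also have "\<dots> = L * T * \<bar>max 0 (min 1 s) - max 0 (min 1 t)\<bar>"
    unfolding dist_real_def right_diff_distrib[symmetric] abs_mult using T by (simp add: abs_minus_commute)
  also have "\<dots> \<le> L * T * dist s t"
    using lipschitz_on_nonneg[OF \<gamma>] T by (intro mult_left_mono) (auto simp: dist_real_def)
  finally show "dist (reversal T \<gamma> s) (reversal T \<gamma> t) \<le> L * T * dist s t" .
qed (use lipschitz_on_nonneg[OF \<gamma>] T in simp)

lemma reversal_derivative_in_field:
  assumes \<gamma>: "descent_trajectory G T \<gamma>" and T: "0 < T" and t: "t \<in> {0<..<1}"
    and u: "(reversal T \<gamma> has_vector_derivative u) (at t)"
  shows "\<exists>w\<in>G (reversal T \<gamma> t). u = T *\<^sub>R w"
proof -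
  define s where "s = T * (1 - t)"
  have s: "s \<in> {0<..<T}" "1 - s / T = t" "\<gamma> s = reversal T \<gamma> t"
    using t T by (auto simp: s_def reversal_def)
  have "((\<lambda>r. 1 - r / T) has_vector_derivative (- inverse T)) (at s)"
    using T by (auto intro!: derivative_eq_intros simp: divide_inverse)
  from vector_diff_chain_at[OF this, of "reversal T \<gamma>" u]
  have "(reversal T \<gamma> \<circ> (\<lambda>r. 1 - r / T) has_vector_derivative (- inverse T) *\<^sub>R u) (at s)"
    using u s(2) by simp
  then have "(\<gamma> has_vector_derivative (- inverse T) *\<^sub>R u) (at s)"
    by (rule has_vector_derivative_transform_within_open[of _ _ _ "{0<..<T}"])
      (use s T in \<open>auto simp: reversal_def min_def max_def field_simps\<close>)
  then have "inverse T *\<^sub>R u \<in> G (reversal T \<gamma> t)"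
    using \<gamma> s(1,3) unfolding descent_trajectory_def by fastforce
  then show ?thesis using T by (intro bexI[of _ "inverse T *\<^sub>R u"]) auto
qed

context bilevel
begin

text \<open>The trajectory is traversed backwards because the supremum in \<open>field_integrand\<close> bounds
  \<open>c' \<bullet> d\<close> from above, and \<open>d\<close> is not known to attain it.\<close>
lemma lyapunov_rate_reversal:
  fixes T :: real and \<gamma>
  defines "\<sigma> \<equiv> reversal T \<gamma>"
  assumes T: "0 < T" and \<gamma>: "descent_trajectory directions T \<gamma>" and t: "t \<in> {0<..<1}"
    and diff: "\<sigma> differentiable (at t)" "(\<lambda>s. newton_point (\<sigma> s)) differentiable (at t)"
  shows "0 \<le> lyapunov_rate \<sigma> t" and "0 \<notin> directions (\<sigma> t) \<Longrightarrow> 0 < lyapunov_rate \<sigma> t"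
proof -
  have u: "(\<sigma> has_vector_derivative vector_derivative \<sigma> (at t)) (at t)"
    using diff(1) vector_derivative_works by blast
  then obtain d where d: "d \<in> Df (newton_point (\<sigma> t))"
    "vector_derivative \<sigma> (at t) = T *\<^sub>R direction (\<sigma> t) d"
    using reversal_derivative_in_field[OF \<gamma> T t] unfolding \<sigma>_def directions_def by blast
  have le: "T * dissipation (\<sigma> t) d \<le> lyapunov_rate \<sigma> t"
    by (rule dissipation_le_lyapunov_rate[OF u[unfolded d(2)] T diff(2) d(1)])
  moreover have "0 \<le> T * dissipation (\<sigma> t) d" using T dissipation_nonneg[of "\<sigma> t" d] by simp
  ultimately show "0 \<le> lyapunov_rate \<sigma> t" by linarith
  assume "0 \<notin> directions (\<sigma> t)"
  moreover have "direction (\<sigma> t) d \<in> directions (\<sigma> t)" using d(1) by (simp add: directions_def)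
  ultimately have "direction (\<sigma> t) d \<noteq> 0" by auto
  then have "0 < T * dissipation (\<sigma> t) d" using T dissipation_pos by simp
  with le show "0 < lyapunov_rate \<sigma> t" by linarith
qed

theorem lyapunov_decreases:
  assumes T: "0 < T" and \<gamma>: "descent_trajectory directions T \<gamma>" and start: "0 \<notin> directions (\<gamma> 0)"
  shows "lyapunov (\<gamma> T) < lyapunov (\<gamma> 0)"
proof -
  define \<sigma> where "\<sigma> = reversal T \<gamma>"
  obtain L where L: "L-lipschitz_on {0..T} \<gamma>" using \<gamma> unfolding descent_trajectory_def by blast
  have \<sigma>: "(L * T)-lipschitz_on UNIV \<sigma>" unfolding \<sigma>_def by (rule lipschitz_reversal[OF L T])
  have "bounded (\<gamma> ` {0..T})"
    by (intro compact_imp_bounded compact_continuous_image lipschitz_on_continuous_on[OF L] compact_Icc)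
  then have "bounded (range \<sigma>)"
    unfolding \<sigma>_def by (rule bounded_subset[OF _ range_reversal_subset[OF T]])
  from lyapunov_increment_integral[OF \<sigma> this] obtain N where N: "negligible N"
    and diff: "\<forall>t. t \<notin> N \<longrightarrow> \<sigma> differentiable (at t) \<and> (\<lambda>s. newton_point (\<sigma> s)) differentiable (at t)"
    and integral: "(lyapunov_rate \<sigma> has_integral (lyapunov (\<sigma> 1) - lyapunov (\<sigma> 0))) {0..1}" .
  note rate = lyapunov_rate_reversal[OF T \<gamma>, folded \<sigma>_def]
  have "open {z. 0 \<notin> directions z}" using closed_stationary by (simp add: open_closed Compl_eq)
  then have "\<forall>\<^sub>F t in at_left 1. \<sigma> t \<in> {z. 0 \<notin> directions z}"
    using continuous_on_imp_continuous_within[OF lipschitz_on_continuous_on[OF \<sigma>], of "{..<1}" 1] start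
    by (intro topological_tendstoD) (auto simp: \<sigma>_def continuous_within)
  then obtain a where a: "a < 1" "\<And>t. \<lbrakk>a < t; t < 1\<rbrakk> \<Longrightarrow> 0 \<notin> directions (\<sigma> t)"
    by (auto simp: eventually_at_left_field)
  define U where "U = {max a 0<..<1}"
  have "0 < lyapunov (\<sigma> 1) - lyapunov (\<sigma> 0)"
  proof (rule has_integral_pos_ae[OF integral])
    show "negligible (N \<union> {0, 1})" by (rule negligible_Un[OF N negligible_finite]) simp
    show "\<not> negligible U" using open_not_negligible[of U] a(1) by (simp add: U_def)
    show "0 \<le> lyapunov_rate \<sigma> t" if "t \<in> {0..1} - (N \<union> {0, 1})" for t
      using rate(1)[of t] diff that by auto
    show "0 < lyapunov_rate \<sigma> t" if "t \<in> U - (N \<union> {0, 1})" for t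
      using rate(2)[of t] diff a(2)[of t] that by (auto simp: U_def)
  qed (auto simp: U_def)
  then show ?thesis by (simp add: \<sigma>_def)
qed

end

section \<open>The iteration\<close>

locale bilevel_iteration = bilevel g gx gy Hxy Hyy \<mu> Lg Qg f Df Mf \<beta>
  for g :: "('n::finite, 'p::finite) point \<Rightarrow> real" and gx gy Hxy Hyy \<mu> Lg Qg f Df Mf \<beta> +
  fixes x :: "nat \<Rightarrow> real^'n" and y :: "nat \<Rightarrow> real^'p" and w :: "nat \<Rightarrow> real^'p"
    and dx :: "nat \<Rightarrow> real^'n" and dy :: "nat \<Rightarrow> real^'p"
    and \<eta> \<epsilon> :: "nat \<Rightarrow> real"
  assumes w_inexact: "\<And>k. norm (Hyy (x k, y k) *v w k - gy (x k, y k)) \<le> \<epsilon> k"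
    and d_choice: "\<And>k. (dx k, dy k) \<in> Df (x k, y k - w k)"
    and x_step: "\<And>k. x (Suc k) = x k - \<eta> k *\<^sub>R
                   (dx k - Hxy (x k, y k) *v (matrix_inv (Hyy (x k, y k)) *v dy k))"
    and y_step: "\<And>k. y (Suc k) = y k - \<eta> k *\<^sub>R
                   (\<beta> *\<^sub>R gy (x k, y k) - matrix_inv (Hyy (x k, y k)) *v
                      (transpose (Hxy (x k, y k)) *v
                        (dx k - Hxy (x k, y k) *v (matrix_inv (Hyy (x k, y k)) *v dy k))))"
    and iterates_bounded: "\<exists>B. \<forall>k. norm (x k) + norm (y k) \<le> B"
    and eta_nonneg: "\<And>k. \<eta> k \<ge> 0"
    and eta_not_summable: "\<not> summable \<eta>"
    and eta_sq_summable: "summable (\<lambda>k. (\<eta> k)\<^sup>2)"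
    and crit_values: "interior {f z | z. BLO_stationary Df Hxy Hyy gy z} = {}"
    and eps_lim: "\<epsilon> \<longlonglongrightarrow> 0"
begin

definition iterate :: "nat \<Rightarrow> ('n, 'p) point" where "iterate k = (x k, y k)"

definition step_direction :: "nat \<Rightarrow> ('n, 'p) point"
  where "step_direction k = direction (iterate k) (dx k, dy k)"

lemma iterate_Suc: "iterate (Suc k) = iterate k - \<eta> k *\<^sub>R step_direction k"
  by (simp add: iterate_def step_direction_def direction_def lifted_hypergradient_def
      hypergradient_def Hinv_def x_step y_step)

lemma iterate_bounded: "bounded (range iterate)"
proof -
  obtain B where "\<And>k. norm (x k) + norm (y k) \<le> B" using iterates_bounded by blast
  then have "norm (iterate k) \<le> B" for k
    unfolding iterate_def by (rule order_trans[OF norm_Pair_le])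
  then show ?thesis by (auto simp: bounded_iff)
qed

lemma step_direction_bounded: "bounded (range step_direction)"
proof -
  obtain B where B: "0 \<le> B" "\<And>k. norm (gy (iterate k)) \<le> B"
    using gy_bounded_on[OF iterate_bounded] by auto
  let ?p = "\<lambda>k. hypergradient (iterate k) (dx k, dy k)" and ?P = "(1 + Lg / \<mu>) * Mf"
  have p: "norm (?p k) \<le> ?P" for k
    by (rule order_trans[OF norm_hypergradient])
      (use Df_bound[OF d_choice] Lg_pos \<mu>_pos in \<open>auto intro!: mult_left_mono\<close>)
  have "norm (step_direction k) \<le> ?P + \<beta> * B + Lg / \<mu> * ?P" for k
  proof -
    have "norm (step_direction k) \<le> norm (?p k) + \<beta> * norm (gy (iterate k)) + Lg / \<mu> * norm (?p k)"
      unfolding step_direction_def by (rule norm_direction)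
    also have "\<dots> \<le> ?P + \<beta> * B + Lg / \<mu> * ?P"
      using \<beta>_pos Lg_pos \<mu>_pos by (intro add_mono mult_left_mono p B(2)) auto
    finally show ?thesis .
  qed
  then show ?thesis by (auto simp: bounded_iff)
qed

lemma inexact_newton_tendsto: "(\<lambda>k. w k - newton (iterate k)) \<longlonglongrightarrow> 0"
proof (rule Lim_null_comparison)
  have "norm (w k - newton (iterate k)) \<le> \<epsilon> k / \<mu>" for k
  proof -
    have "Hyy (iterate k) *v (w k - newton (iterate k)) = Hyy (iterate k) *v w k - gy (iterate k)"
      by (simp add: matrix_vector_mult_diff_distrib newton_def)
    then show ?thesis
      using norm_le_Hyy[of "w k - newton (iterate k)" "iterate k"]
        divide_right_mono[OF w_inexact[of k], of \<mu>] \<mu>_pos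
      by (simp add: iterate_def)
  qed
  then show "\<forall>\<^sub>F k in sequentially. norm (w k - newton (iterate k)) \<le> \<epsilon> k / \<mu>" by simp
  show "(\<lambda>k. \<epsilon> k / \<mu>) \<longlonglongrightarrow> 0" by (rule tendsto_divide_zero[OF eps_lim])
qed

lemma step_direction_limit:
  assumes r: "strict_mono r" and p: "(\<lambda>j. iterate (r j)) \<longlonglongrightarrow> p" and u: "(\<lambda>j. step_direction (r j)) \<longlonglongrightarrow> u"
  shows "u \<in> directions p"
proof (rule directions_limit[OF p])
  have "(\<lambda>j. w (r j) - newton (iterate (r j))) \<longlonglongrightarrow> 0"
    using LIMSEQ_subseq_LIMSEQ[OF inexact_newton_tendsto r] by (simp add: o_def)
  then have "(\<lambda>j. newton_point (iterate (r j)) - (0, w (r j) - newton (iterate (r j))))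
      \<longlonglongrightarrow> newton_point p - (0, 0)"
    by (intro tendsto_diff tendsto_Pair tendsto_const newton_point_tendsto p)
  then show "(\<lambda>j. (x (r j), y (r j) - w (r j))) \<longlonglongrightarrow> newton_point p"
    by (simp add: newton_point_eq iterate_def zero_prod_def[symmetric])
  show "(dx (r j), dy (r j)) \<in> Df (x (r j), y (r j) - w (r j))" for j by (rule d_choice)
  show "(\<lambda>j. direction (iterate (r j)) (dx (r j), dy (r j))) \<longlonglongrightarrow> u"
    using u by (simp add: step_direction_def)
qed

lemma eta_tendsto_0: "\<eta> \<longlonglongrightarrow> 0"
  using tendsto_real_sqrt[OF summable_LIMSEQ_zero[OF eta_sq_summable]] eta_nonneg by simp

lemma critical_values_eq:
  "lyapunov ` {z. 0 \<in> directions z} = {f z | z. BLO_stationary Df Hxy Hyy gy z}"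
  unfolding zero_in_directions_iff using lyapunov_stationary by (auto simp: image_def)

sublocale euler_iteration iterate step_direction \<eta> directions
  by unfold_locales
    (rule iterate_Suc iterate_bounded step_direction_bounded eta_nonneg eta_tendsto_0 eta_not_summable
      convex_directions closed_directions step_direction_limit; assumption)+

sublocale lyapunov_trajectory interpolation directions lyapunov "{z. 0 \<in> directions z}"
  by unfold_locales
    (use lyapunov_continuous lyapunov_decreases crit_values in \<open>auto simp: critical_values_eq\<close>)

theorem lyapunov_iterates_convergent: "convergent (\<lambda>k. lyapunov (x k, y k))"
proof -
  obtain c where "((\<lambda>s. lyapunov (interpolation s)) \<longlongrightarrow> c) at_top" using h_X_converges by blast
  from filterlim_compose[OF this time_at_top] show ?thesis
    by (auto simp: interpolation_time iterate_def convergent_def)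
qed

theorem limit_point_stationary:
  assumes r: "strict_mono r" and lim: "(\<lambda>k. (x (r k), y (r k))) \<longlonglongrightarrow> z"
  shows "BLO_stationary Df Hxy Hyy gy z"
proof -
  have "filterlim (\<lambda>k. time (r k)) at_top sequentially"
    by (rule filterlim_compose[OF time_at_top filterlim_subseq[OF r]])
  moreover have "(\<lambda>k. interpolation (time (r k))) \<longlonglongrightarrow> z"
    using lim by (simp add: interpolation_time iterate_def)
  ultimately have "z \<in> {z. 0 \<in> directions z}" by (rule limit_point_in_S)
  then show ?thesis by (simp add: zero_in_directions_iff)
qed

end

theorem theorem4p4:
  fixes f :: "(real^'n) \<times> (real^'p) \<Rightarrow> real"
    and g :: "(real^'n) \<times> (real^'p) \<Rightarrow> real"
    and gx :: "(real^'n) \<times> (real^'p) \<Rightarrow> real^'n"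
    and gy :: "(real^'n) \<times> (real^'p) \<Rightarrow> real^'p"
    and Hxy :: "(real^'n) \<times> (real^'p) \<Rightarrow> real^'p^'n"
    and Hyy :: "(real^'n) \<times> (real^'p) \<Rightarrow> real^'p^'p"
    and Df :: "(real^'n) \<times> (real^'p) \<Rightarrow> ((real^'n) \<times> (real^'p)) set"
    and Mf \<mu> Lg Qg \<beta> :: real
    and x :: "nat \<Rightarrow> real^'n" and y :: "nat \<Rightarrow> real^'p" and w :: "nat \<Rightarrow> real^'p"
    and dx :: "nat \<Rightarrow> real^'n" and dy :: "nat \<Rightarrow> real^'p"
    and \<eta> \<epsilon> :: "nat \<Rightarrow> real"
  assumes consts_pos: "Mf > 0" "\<mu> > 0" "Lg > 0" "Qg > 0"
    \<comment> \<open>(A1)\<close>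
    and f_lip: "Mf-lipschitz_on UNIV f"
    and g_grad: "\<And>z. (g has_derivative (\<lambda>(u, v). gx z \<bullet> u + gy z \<bullet> v)) (at z)"
    and gx_diff: "\<And>z. gx differentiable (at z)"
    and gy_deriv: "\<And>z. (gy has_derivative (\<lambda>(u, v). u v* Hxy z + Hyy z *v v)) (at z)"
    and Hyy_pd: "\<And>z v. v \<bullet> (Hyy z *v v) \<ge> \<mu> * (norm v)\<^sup>2"
    and grad_lip: "Lg-lipschitz_on UNIV (\<lambda>z. (gx z, gy z))"
    and Hyy_lip: "\<And>z z'. opnorm (Hyy z - Hyy z') \<le> Qg * dist z z'"
    and Hxy_lip: "\<And>z z'. opnorm (Hxy z - Hxy z') \<le> Qg * dist z z'"
    and Hyy_C1: "\<exists>DH :: (real^'n) \<times> (real^'p) \<Rightarrow> ((real^'n) \<times> (real^'p)) \<Rightarrow>\<^sub>L (real^'p^'p).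
                   (\<forall>z. (Hyy has_derivative blinfun_apply (DH z)) (at z)) \<and> continuous_on UNIV DH"
    \<comment> \<open>(A2)\<close>
    and Df_cons: "conservative_field Df"
    and f_pot: "potential_of f Df"
    and Df_convex: "\<And>z. convex (Df z)"
    and Df_bound: "\<And>z d. d \<in> Df z \<Longrightarrow> norm d \<le> Mf"
    \<comment> \<open>step size parameter\<close>
    and beta: "\<beta> \<ge> max (8 * Mf * Qg / \<mu> ^ 3) (4 * Mf * Qg * Lg / \<mu> powr 3.5)"
    \<comment> \<open>Algorithm 3\<close>
    and w_inexact: "\<And>k. norm (Hyy (x k, y k) *v w k - gy (x k, y k)) \<le> \<epsilon> k"
    and d_choice: "\<And>k. (dx k, dy k) \<in> Df (x k, y k - w k)"
    and x_step: "\<And>k. x (Suc k) = x k - \<eta> k *\<^sub>R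
                   (dx k - Hxy (x k, y k) *v (matrix_inv (Hyy (x k, y k)) *v dy k))"
    and y_step: "\<And>k. y (Suc k) = y k - \<eta> k *\<^sub>R
                   (\<beta> *\<^sub>R gy (x k, y k) - matrix_inv (Hyy (x k, y k)) *v
                      (transpose (Hxy (x k, y k)) *v
                        (dx k - Hxy (x k, y k) *v (matrix_inv (Hyy (x k, y k)) *v dy k))))"
    \<comment> \<open>(a), (b), (c), and vanishing inexactness\<close>
    and bdd: "\<exists>B. \<forall>k. norm (x k) + norm (y k) \<le> B"
    and eta_nonneg: "\<And>k. \<eta> k \<ge> 0"
    and eta_not_summable: "\<not> summable \<eta>"
    and eta_sq_summable: "summable (\<lambda>k. (\<eta> k)\<^sup>2)"
    and crit_values: "interior {f z | z. BLO_stationary Df Hxy Hyy gy z} = {}"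
    and eps_lim: "\<epsilon> \<longlonglongrightarrow> 0"
  shows "(\<forall>z r. strict_mono r \<and> ((\<lambda>k. (x (r k), y (r k))) \<longlonglongrightarrow> z)
            \<longrightarrow> BLO_stationary Df Hxy Hyy gy z)
         \<and> convergent (\<lambda>k. hfun f \<beta> Hyy gy (x k, y k))"
proof -
  interpret bilevel_iteration g gx gy Hxy Hyy \<mu> Lg Qg f Df Mf \<beta> x y w dx dy \<eta> \<epsilon>
    by unfold_locales (fact assms)+
  show ?thesis
    using limit_point_stationary lyapunov_iterates_convergent by blast
qed

end
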